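(* Let $0<\alpha\le 1$. Let $q,\tilde q$ be real-valued continuous functions on $[0,\pi]$ and $h,H,\tilde h,\tilde H\in\mathbb{R}$. Let $\{\lambda_n\}_{n\ge0}$ be the eigenvalues of the problem $L_\alpha(q,h,H)$: $$-D_x^\alpha D_x^\alpha y+q(x)y=\lambda y,\ 0<x<\pi,\qquad D_x^\alpha y(0)-hy(0)=0,\qquad D_x^\alpha y(\pi)+Hy(\pi)=0,$$ and let $\{\xi_n\}_{n\ge0}$ be the eigenvalues of the problem $L_{\alpha,1}(q,H)$: $$-D_x^\alpha D_x^\alpha y+q(x)y=\lambda y,\ 0<x<\pi,\qquad y(0)=0,\qquad D_x^\alpha y(\pi)+Hy(\pi)=0.$$ Let $\{\tilde\lambda_n\}_{n\ge0}$, $\{\tilde\xi_n\}_{n\ge0}$ be the corresponding eigenvalues for the coefficients $\tilde q,\tilde h,\tilde H$. If $\lambda_n=\tilde\lambda_n$ and $\xi_n=\tilde\xi_n$ for all $n\ge0$, then $q(x)=\tilde q(x)$ a.e. on $[0,\pi]$, $h=\tilde h$ and $H=\tilde H$.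
   Context: $D_x^\alpha$ denotes the conformable fractional derivative of order $\alpha$: for $x>0$, $D^\alpha f(x)=\lim_{\varepsilon\to 0}\frac{f(x+\varepsilon x^{1-\alpha})-f(x)}{\varepsilon}$, and $D^\alpha f(0)=\lim_{x\to0^+}D^\alpha f(x)$ (for differentiable $f$, $D^\alpha f(x)=x^{1-\alpha}f'(x)$). $\lambda$ is a complex spectral parameter. The eigenvalues of each problem are real and simple, and are enumerated in increasing order. *)

theory Defs
  imports "HOL-Analysis.Analysis"
begin

text \<open>Conformable fractional derivative of order alpha of a function on [0,pi] at a point
  x in (0,pi]: the limit of (f (x + e x^(1-alpha)) - f x)/e as e tends to 0, where only
  increments keeping the argument inside [0,pi] are used (so at x = pi it is one-sided).\<close>
definition conf_deriv_at :: "real \<Rightarrow> (real \<Rightarrow> complex) \<Rightarrow> complex \<Rightarrow> real \<Rightarrow> bool" where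
  "conf_deriv_at \<alpha> f d x \<longleftrightarrow>
     ((\<lambda>e. (f (x + e * x powr (1 - \<alpha>)) - f x) / complex_of_real e) \<longlongrightarrow> d)
       (at 0 within {e. 0 \<le> x + e * x powr (1 - \<alpha>) \<and> x + e * x powr (1 - \<alpha>) \<le> pi})"

text \<open>y is a nontrivial solution of  - D^a D^a y + q y = lam y  on (0,pi), with u = D^a y
  (u 0 = D^a y(0) is the right limit of D^a y, encoded by continuity of u on [0,pi]).\<close>
definition conf_sl_solution ::
  "real \<Rightarrow> (real \<Rightarrow> real) \<Rightarrow> complex \<Rightarrow> (real \<Rightarrow> complex) \<Rightarrow> (real \<Rightarrow> complex) \<Rightarrow> bool" where
  "conf_sl_solution \<alpha> q lam y u \<longleftrightarrow>
     (\<exists>x\<in>{0..pi}. y x \<noteq> 0) \<and>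
     continuous_on {0..pi} y \<and> continuous_on {0..pi} u \<and>
     (\<forall>x\<in>{0<..pi}. conf_deriv_at \<alpha> y (u x) x) \<and>
     (\<exists>v. \<forall>x\<in>{0<..<pi}. conf_deriv_at \<alpha> u (v x) x \<and>
            - v x + complex_of_real (q x) * y x = lam * y x)"

definition eig_L :: "real \<Rightarrow> (real \<Rightarrow> real) \<Rightarrow> real \<Rightarrow> real \<Rightarrow> complex set" where
  "eig_L \<alpha> q h H = {lam. \<exists>y u. conf_sl_solution \<alpha> q lam y u \<and>
       u 0 - complex_of_real h * y 0 = 0 \<and> u pi + complex_of_real H * y pi = 0}"

definition eig_L1 :: "real \<Rightarrow> (real \<Rightarrow> real) \<Rightarrow> real \<Rightarrow> complex set" where
  "eig_L1 \<alpha> q H = {lam. \<exists>y u. conf_sl_solution \<alpha> q lam y u \<and>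
       y 0 = 0 \<and> u pi + complex_of_real H * y pi = 0}"

definition enumerates_incr :: "(nat \<Rightarrow> real) \<Rightarrow> complex set \<Rightarrow> bool" where
  "enumerates_incr s E \<longleftrightarrow> strict_mono s \<and> E = complex_of_real ` range s"

end

theory Submission
  imports Defs "HOL-Complex_Analysis.Complex_Analysis"
begin

text \<open>
  The substitution \<open>t = x\<^sup>\<alpha> / \<alpha>\<close> turns the problem into \<open>- y'' + p y = \<lambda> y\<close> on \<open>[0, T]\<close>. Let \<open>\<phi>, S\<close> be
  the solutions with initial data \<open>(1, h)\<close> and \<open>(0, 1)\<close> at 0. The two spectra are the zero sets of the
  entire functions \<open>N = \<phi>'(T) + H \<phi>(T)\<close> and \<open>D = S'(T) + H S(T)\<close> of \<open>\<lambda>\<close>. By Green's identity their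
  zeros are real and simple, and with \<open>\<lambda> = k\<^sup>2\<close> one has \<open>N \<sim> - k sin kT\<close> and \<open>D \<sim> cos kT\<close> along
  suitable expanding squares in the \<open>k\<close>-plane. So for two problems with the same spectra the quotients
  of their functions \<open>N\<close> and of their functions \<open>D\<close> are entire and tend to 1 along the squares; by the
  maximum principle they are 1.

  The solution \<open>\<psi> = D \<phi> - N S\<close> has data \<open>(1, - H)\<close> at \<open>T\<close>, hence is \<open>O(exp ((T - x) |Im k|))\<close>. If a
  tilde marks the second problem, \<open>N (\<phi> S~ - S \<phi>~) = \<psi> \<phi>~ - \<phi> \<psi>~ = O(exp (T |Im k|))\<close>, so the entire
  function \<open>\<phi> S~ - S \<phi>~\<close> tends to 0 along the squares and vanishes. For nonreal \<open>\<lambda>\<close>, \<open>\<phi>\<close> and \<open>\<phi>~\<close> have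
  no zeros, and as \<open>(S / \<phi>)' = 1 / \<phi>\<^sup>2\<close>, it follows that \<open>\<phi>\<^sup>2 = \<phi>~\<^sup>2\<close>. So \<open>\<phi>\<close> and \<open>\<phi>~\<close> have the same
  logarithmic derivative, which determines \<open>p\<close> and \<open>h\<close>.
\<close>

section \<open>Ordinary differential equations with Lipschitz right-hand side\<close>

lemma norm_has_integral_le:
  fixes f :: "'n::euclidean_space \<Rightarrow> 'a::banach"
  assumes "(f has_integral I) S" "(g has_integral J) S" "\<And>t. t \<in> S \<Longrightarrow> norm (f t) \<le> g t"
  shows "norm I \<le> J"
  using integral_norm_bound_integral[of f S g] assms by (auto simp: has_integral_iff)

lemma continuous_on_Icc_bound:
  fixes f :: "real \<Rightarrow> 'a::real_normed_vector"
  assumes "continuous_on {a..b} f"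
  obtains M where "0 < M" "\<And>t. t \<in> {a..b} \<Longrightarrow> norm (f t) \<le> M"
  using compact_imp_bounded[OF compact_continuous_image[OF assms compact_Icc]]
  unfolding bounded_pos by blast

lemma has_vector_derivative_Icc_if_interior:
  fixes f :: "real \<Rightarrow> 'a::banach"
  assumes f: "continuous_on {a..b} f" and g: "continuous_on {a..b} g"
    and deriv: "\<And>x. x \<in> {a<..<b} \<Longrightarrow> (f has_vector_derivative g x) (at x)"
    and x: "x \<in> {a..b}"
  shows "(f has_vector_derivative g x) (at x within {a..b})"
proof (rule has_vector_derivative_transform[OF x])
  show "f y = f a + integral {a..y} g" if y: "y \<in> {a..b}" for y
  proof -
    have "(g has_integral (f y - f a)) {a..y}"
      using f deriv y
      by (intro fundamental_theorem_of_calculus_interior) (auto elim: continuous_on_subset)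
    then show ?thesis by (simp add: integral_unique)
  qed
  show "((\<lambda>y. f a + integral {a..y} g) has_vector_derivative g x) (at x within {a..b})"
    using integral_has_vector_derivative[OF g x]
    by (auto intro!: derivative_eq_intros)
qed

lemma has_vector_derivative_Icc_eq:
  fixes f g :: "real \<Rightarrow> 'a::real_normed_vector"
  assumes "(f has_vector_derivative f') (at x within {a..b})"
    "(g has_vector_derivative g') (at x within {a..b})"
    and eq: "\<And>y. y \<in> {a..b} \<Longrightarrow> f y = g y" and x: "a < b" "x \<in> {a..b}"
  shows "f' = g'"
proof -
  have "(f has_vector_derivative g') (at x within {a..b})"
    by (rule has_vector_derivative_transform[OF x(2) eq assms(2)])
  with assms(1) x show ?thesis
    by (intro vector_derivative_unique_within_closed_interval[of a b x f]) simp_all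
qed

lemma gronwall:
  fixes f :: "real \<Rightarrow> real"
  assumes f: "continuous_on {a..b} f" and K: "0 \<le> K"
    and le: "\<And>t. t \<in> {a..b} \<Longrightarrow> f t \<le> A + K * integral {a..t} f" and x: "x \<in> {a..b}"
  shows "f x \<le> A * exp (K * (x - a))"
proof -
  define G where "G t = A + K * integral {a..t} f" for t
  have deriv: "(G has_real_derivative K * f t) (at t within {a..b})" if "t \<in> {a..b}" for t
    unfolding G_def using integral_has_real_derivative[OF f that]
    by (auto intro!: derivative_eq_intros)
  have decay: "G x * exp (- K * (x - a)) \<le> G a * exp (- K * (a - a))"
  proof (rule DERIV_nonpos_imp_decreasing_open[where f = "\<lambda>t. G t * exp (- K * (t - a))"])
    fix t assume t: "a < t" "t < x"
    then have "(G has_real_derivative K * f t) (at t)"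
      using deriv[of t] x by (auto simp: at_within_Icc_at)
    then have "((\<lambda>t. G t * exp (- K * (t - a))) has_real_derivative
        K * exp (- K * (t - a)) * (f t - G t)) (at t)"
      by (auto intro!: derivative_eq_intros simp: algebra_simps)
    moreover have "K * exp (- K * (t - a)) * (f t - G t) \<le> 0"
      using le[of t] t x K by (auto simp: G_def intro!: mult_nonneg_nonpos)
    ultimately show "\<exists>D. ((\<lambda>t. G t * exp (- K * (t - a))) has_real_derivative D) (at t) \<and> D \<le> 0"
      by blast
  next
    have "continuous_on {a..b} G" by (rule DERIV_continuous_on) (rule deriv)
    then have "continuous_on {a..x} G" by (rule continuous_on_subset) (use x in auto)
    then show "continuous_on {a..x} (\<lambda>t. G t * exp (- K * (t - a)))"
      by (intro continuous_intros)
  qed (use x in auto)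
  have "f x \<le> G x" using le[OF x] by (simp add: G_def)
  also have "\<dots> = G x * exp (- K * (x - a)) * exp (K * (x - a))" by (simp add: exp_minus)
  also have "\<dots> \<le> A * exp (K * (x - a))"
    using decay by (intro mult_right_mono) (auto simp: G_def)
  finally show ?thesis .
qed

lemma lipschitz_ode_perturbation:
  fixes f :: "real \<Rightarrow> 'a::banach \<Rightarrow> 'a"
  assumes y: "\<And>t. t \<in> {a..b} \<Longrightarrow> (y has_vector_derivative f t (y t)) (at t within {a..b})"
    and z: "\<And>t. t \<in> {a..b} \<Longrightarrow> (z has_vector_derivative w t) (at t within {a..b})"
    and w: "\<And>t. t \<in> {a..b} \<Longrightarrow> norm (f t (z t) - w t) \<le> \<epsilon>"
    and lip: "\<And>t. t \<in> {a..b} \<Longrightarrow> L-lipschitz_on UNIV (f t)"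
    and x: "x \<in> {a..b}"
  shows "norm (y x - z x) \<le> (norm (y a - z a) + \<epsilon> * (b - a)) * exp (L * (x - a))"
proof -
  define d where "d t = y t - z t" for t
  have a_mem: "a \<in> {a..b}" using x by auto
  have L: "0 \<le> L" by (rule lipschitz_on_nonneg[OF lip[OF a_mem]])
  have \<epsilon>: "0 \<le> \<epsilon>" by (rule order_trans[OF norm_ge_zero w[OF a_mem]])
  have d': "(d has_vector_derivative f t (y t) - w t) (at t within {a..b})" if "t \<in> {a..b}" for t
    unfolding d_def using y z that by (intro derivative_intros) auto
  have d: "continuous_on {a..b} d"
    using d' by (rule continuous_on_vector_derivative)
  have rate: "norm (f t (y t) - w t) \<le> L * norm (d t) + \<epsilon>" if t: "t \<in> {a..b}" for t
  proof -
    have "norm (f t (y t) - f t (z t)) \<le> L * norm (d t)"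
      using lipschitz_onD[OF lip[OF t], of "y t" "z t"] by (simp add: dist_norm d_def)
    with w[OF t] show ?thesis
      using norm_triangle_ineq[of "f t (y t) - f t (z t)" "f t (z t) - w t"] by simp
  qed
  have "norm (d x) \<le> (norm (d a) + \<epsilon> * (b - a)) * exp (L * (x - a))"
  proof (rule gronwall[OF _ L _ x])
    fix t assume t: "t \<in> {a..b}"
    then have sub: "{a..t} \<subseteq> {a..b}" by auto
    have "((\<lambda>t. f t (y t) - w t) has_integral (d t - d a)) {a..t}"
      using t
      by (intro fundamental_theorem_of_calculus has_vector_derivative_within_subset[OF d' sub]) auto
    moreover have "((\<lambda>s. L * norm (d s) + \<epsilon>) has_integral
        L * integral {a..t} (\<lambda>s. norm (d s)) + \<epsilon> * (t - a)) {a..t}"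
      using t has_integral_const_real[of \<epsilon> a t]
      by (intro has_integral_add has_integral_mult_right integrable_integral
          integrable_continuous_interval continuous_intros continuous_on_subset[OF d sub])
        (simp add: mult.commute)
    ultimately have "norm (d t - d a) \<le> L * integral {a..t} (\<lambda>s. norm (d s)) + \<epsilon> * (t - a)"
      by (rule norm_has_integral_le) (use rate sub in auto)
    also have "\<dots> \<le> L * integral {a..t} (\<lambda>s. norm (d s)) + \<epsilon> * (b - a)"
      using t \<epsilon> by (intro add_left_mono mult_left_mono) auto
    finally show "norm (d t) \<le> norm (d a) + \<epsilon> * (b - a) + L * integral {a..t} (\<lambda>s. norm (d s))"
      using norm_triangle_sub[of "d t" "d a"] by simp
  qed (intro continuous_intros d)
  then show ?thesis by (simp add: d_def)
qed

lemma lipschitz_integral_diff_exp_le: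
  fixes f :: "real \<Rightarrow> 'a::banach \<Rightarrow> 'b::banach"
  assumes lip: "\<And>s. s \<in> {a..t} \<Longrightarrow> L-lipschitz_on UNIV (f s)" and K: "0 < K" and t: "a \<le> t"
    and y: "continuous_on {a..t} (\<lambda>s. f s (y s))" and z: "continuous_on {a..t} (\<lambda>s. f s (z s))"
    and d: "\<And>s. s \<in> {a..t} \<Longrightarrow> norm (y s - z s) \<le> d * exp (K * s)"
  shows "norm (integral {a..t} (\<lambda>s. f s (y s)) - integral {a..t} (\<lambda>s. f s (z s)))
           \<le> L / K * (d * exp (K * t))"
proof -
  have L: "0 \<le> L" using lipschitz_on_nonneg[OF lip[of a]] t by simp
  have d0: "0 \<le> d" using order_trans[OF norm_ge_zero d[of a]] t by (simp add: zero_le_mult_iff)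
  have "((\<lambda>s. f s (y s) - f s (z s)) has_integral
      integral {a..t} (\<lambda>s. f s (y s)) - integral {a..t} (\<lambda>s. f s (z s))) {a..t}"
    by (intro has_integral_diff integrable_integral integrable_continuous_interval y z)
  moreover have "((\<lambda>s. L * (d * exp (K * s))) has_integral
      L * (d * exp (K * t)) / K - L * (d * exp (K * a)) / K) {a..t}"
    using K t by (intro fundamental_theorem_of_calculus)
      (auto intro!: derivative_eq_intros simp flip: has_real_derivative_iff_has_vector_derivative)
  moreover have "norm (f s (y s) - f s (z s)) \<le> L * (d * exp (K * s))" if "s \<in> {a..t}" for s
    using lipschitz_onD[OF lip[OF that], of "y s" "z s"] mult_left_mono[OF d[OF that] L]
    by (simp add: dist_norm)
  ultimately have "norm (integral {a..t} (\<lambda>s. f s (y s)) - integral {a..t} (\<lambda>s. f s (z s)))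
      \<le> L * (d * exp (K * t)) / K - L * (d * exp (K * a)) / K"
    by (rule norm_has_integral_le)
  also have "\<dots> \<le> L / K * (d * exp (K * t))"
    using L K d0 by simp
  finally show ?thesis .
qed

lemma contraction_fixpoint_cbox:
  fixes V :: "('n::euclidean_space \<Rightarrow> 'a::complete_space) \<Rightarrow> 'n \<Rightarrow> 'a"
  assumes cont: "\<And>z. continuous_on (cbox a b) z \<Longrightarrow> continuous_on (cbox a b) (V z)"
    and contr: "\<And>z w d t. continuous_on (cbox a b) z \<Longrightarrow> continuous_on (cbox a b) w \<Longrightarrow>
      (\<And>s. s \<in> cbox a b \<Longrightarrow> dist (z s) (w s) \<le> d) \<Longrightarrow> t \<in> cbox a b \<Longrightarrow> dist (V z t) (V w t) \<le> c * d"
    and c: "0 \<le> c" "c < 1" and nonempty: "cbox a b \<noteq> {}"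
  obtains z where "continuous_on (cbox a b) z" "\<And>t. t \<in> cbox a b \<Longrightarrow> V z t = z t"
proof -
  have z: "continuous_on (cbox a b) (apply_bcontfun z)" for z :: "'n \<Rightarrow>\<^sub>C 'a"
    by (rule continuous_on_subset[OF continuous_on_apply_bcontfun]) auto
  have "\<exists>w :: 'n \<Rightarrow>\<^sub>C 'a. \<forall>t. apply_bcontfun w t = V (apply_bcontfun z) (clamp a b t)" for z
    using continuous_on_cbox_bcontfunE[OF cont[OF z]] by metis
  then obtain F :: "('n \<Rightarrow>\<^sub>C 'a) \<Rightarrow> ('n \<Rightarrow>\<^sub>C 'a)"
    where F: "\<And>z t. apply_bcontfun (F z) t = V (apply_bcontfun z) (clamp a b t)"
    by metis
  have "dist (F z) (F w) \<le> c * dist z w" for z w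
  proof (rule dist_bound)
    fix t
    have "clamp a b t \<in> cbox a b"
      using nonempty by (intro clamp_in_interval) (auto simp: box_ne_empty)
    then show "dist (apply_bcontfun (F z) t) (apply_bcontfun (F w) t) \<le> c * dist z w"
      unfolding F by (intro contr z dist_bounded)
  qed
  then obtain z where "F z = z"
    using banach_fix_type[OF c] by blast
  then have "V (apply_bcontfun z) t = apply_bcontfun z t" if "t \<in> cbox a b" for t
    using F[of z t] that by simp
  with z show ?thesis by (rule that)
qed

lemma lipschitz_integral_equation_exists:
  fixes f :: "real \<Rightarrow> 'a::banach \<Rightarrow> 'a"
  assumes ab: "a \<le> b" and cont: "continuous_on ({a..b} \<times> UNIV) (\<lambda>(t, z). f t z)"
    and lip: "\<And>t. t \<in> {a..b} \<Longrightarrow> L-lipschitz_on UNIV (f t)"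
  obtains y where "continuous_on {a..b} y"
    "\<And>t. t \<in> {a..b} \<Longrightarrow> y t = y\<^sub>0 + integral {a..t} (\<lambda>s. f s (y s))"
proof -
  have L: "0 \<le> L" using lipschitz_on_nonneg[OF lip[of a]] ab by simp
  define K where "K = 2 * L + 1"
  have K: "0 < K" "L / K \<le> 1 / 2" using L by (auto simp: K_def divide_simps)
  \<comment> \<open>In the variable \<open>exp (- K t) *\<^sub>R y t\<close> the Picard operator contracts the sup norm by \<open>L / K\<close>.\<close>
  define I where "I z t = integral {a..t} (\<lambda>s. f s (exp (K * s) *\<^sub>R z s))" for z and t :: real
  define V where "V z t = exp (- K * t) *\<^sub>R (y\<^sub>0 + I z t)" for z t
  have integrand: "continuous_on {a..b} (\<lambda>s. f s (exp (K * s) *\<^sub>R z s))"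
    if "continuous_on {a..b} z" for z
    by (rule continuous_on_compose2[OF cont, of _ "\<lambda>s. (s, exp (K * s) *\<^sub>R z s)", simplified])
      (auto intro!: continuous_intros that)
  have continuous: "continuous_on {a..b} (V z)" if "continuous_on {a..b} z" for z
    unfolding V_def I_def
    by (intro continuous_intros indefinite_integral_continuous_1 integrable_continuous_interval
        integrand that)
  have contraction: "dist (V z t) (V w t) \<le> 1 / 2 * d"
    if z: "continuous_on {a..b} z" and w: "continuous_on {a..b} w"
      and d: "\<And>s. s \<in> {a..b} \<Longrightarrow> dist (z s) (w s) \<le> d" and t: "t \<in> {a..b}" for z w d t
  proof -
    have sub: "{a..t} \<subseteq> {a..b}" using t by auto
    have d0: "0 \<le> d" by (rule order_trans[OF zero_le_dist d[OF t]])
    have "norm (I z t - I w t) \<le> L / K * (d * exp (K * t))"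
      unfolding I_def using t sub K d
      by (intro lipschitz_integral_diff_exp_le lip continuous_on_subset[OF integrand sub] z w)
        (auto simp: dist_norm simp flip: scaleR_diff_right)
    also have "\<dots> \<le> 1 / 2 * (d * exp (K * t))"
      using K d0 by (intro mult_right_mono) auto
    finally have "exp (- K * t) * norm (I z t - I w t)
        \<le> exp (- K * t) * (1 / 2 * (d * exp (K * t)))"
      by (rule mult_left_mono) simp
    also have "\<dots> = 1 / 2 * d" by (simp add: exp_minus)
    finally show ?thesis unfolding V_def dist_norm by (simp flip: scaleR_diff_right)
  qed
  obtain z where z: "continuous_on {a..b} z" and fixpoint: "\<And>t. t \<in> {a..b} \<Longrightarrow> V z t = z t"
    by (rule contraction_fixpoint_cbox[of a b V "1 / 2", unfolded cbox_interval,
          OF continuous contraction])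
      (use ab in auto)
  show ?thesis
  proof (rule that)
    show "continuous_on {a..b} (\<lambda>t. exp (K * t) *\<^sub>R z t)"
      by (intro continuous_intros z)
    show "exp (K * t) *\<^sub>R z t = y\<^sub>0 + integral {a..t} (\<lambda>s. f s (exp (K * s) *\<^sub>R z s))"
      if "t \<in> {a..b}" for t
      by (subst fixpoint[OF that, symmetric]) (simp add: V_def I_def exp_minus)
  qed
qed

lemma lipschitz_ode_exists:
  fixes f :: "real \<Rightarrow> 'a::banach \<Rightarrow> 'a"
  assumes ab: "a \<le> b" and cont: "continuous_on ({a..b} \<times> UNIV) (\<lambda>(t, z). f t z)"
    and lip: "\<And>t. t \<in> {a..b} \<Longrightarrow> L-lipschitz_on UNIV (f t)"
  obtains y where "y a = y\<^sub>0"
    "\<And>t. t \<in> {a..b} \<Longrightarrow> (y has_vector_derivative f t (y t)) (at t within {a..b})"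
proof -
  obtain y where y: "continuous_on {a..b} y"
    and eq: "\<And>t. t \<in> {a..b} \<Longrightarrow> y t = y\<^sub>0 + integral {a..t} (\<lambda>s. f s (y s))"
    using lipschitz_integral_equation_exists[OF ab cont lip] by metis
  have integrand: "continuous_on {a..b} (\<lambda>s. f s (y s))"
    by (rule continuous_on_compose2[OF cont, of _ "\<lambda>s. (s, y s)", simplified])
      (auto intro!: continuous_intros y)
  show ?thesis
  proof (rule that)
    show "y a = y\<^sub>0" using eq[of a] ab by simp
    fix t assume t: "t \<in> {a..b}"
    have "((\<lambda>t. y\<^sub>0 + integral {a..t} (\<lambda>s. f s (y s))) has_vector_derivative f t (y t))
        (at t within {a..b})"
      using integral_has_vector_derivative[OF integrand t] by (auto intro!: derivative_eq_intros)
    then show "(y has_vector_derivative f t (y t)) (at t within {a..b})"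
      by (rule has_vector_derivative_transform[OF t, rotated]) (rule eq)
  qed
qed

section \<open>The Sturm--Liouville equation\<close>

definition sl_solution ::
  "real \<Rightarrow> (real \<Rightarrow> complex) \<Rightarrow> (real \<Rightarrow> complex) \<Rightarrow> (real \<Rightarrow> complex) \<Rightarrow> bool" where
  "sl_solution T Q y u \<longleftrightarrow> (\<forall>x\<in>{0..T}.
     (y has_vector_derivative u x) (at x within {0..T}) \<and>
     (u has_vector_derivative Q x * y x) (at x within {0..T}))"

lemma sl_solutionD:
  assumes "sl_solution T Q y u" "x \<in> {0..T}"
  shows "(y has_vector_derivative u x) (at x within {0..T})"
    and "(u has_vector_derivative Q x * y x) (at x within {0..T})"
  using assms by (auto simp: sl_solution_def)

lemma sl_solution_continuous_on:
  assumes "sl_solution T Q y u"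
  shows "continuous_on {0..T} y" "continuous_on {0..T} u"
  using assms by (auto simp: sl_solution_def intro: continuous_on_vector_derivative)

lemma sl_solution_cong:
  assumes "sl_solution T Q y u"
    and eq: "\<And>x. x \<in> {0..T} \<Longrightarrow> Q' x = Q x" "\<And>x. x \<in> {0..T} \<Longrightarrow> y' x = y x"
      "\<And>x. x \<in> {0..T} \<Longrightarrow> u' x = u x"
  shows "sl_solution T Q' y' u'"
  unfolding sl_solution_def
proof
  fix x assume x: "x \<in> {0..T}"
  show "(y' has_vector_derivative u' x) (at x within {0..T}) \<and>
      (u' has_vector_derivative Q' x * y' x) (at x within {0..T})"
    unfolding eq[OF x]
    using has_vector_derivative_transform[OF x eq(2) sl_solutionD(1)[OF assms(1) x]]
      has_vector_derivative_transform[OF x eq(3) sl_solutionD(2)[OF assms(1) x]] by blast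
qed

lemma sl_solution_lincomb:
  assumes "sl_solution T Q y u" "sl_solution T Q z v"
  shows "sl_solution T Q (\<lambda>x. a * y x + b * z x) (\<lambda>x. a * u x + b * v x)"
  unfolding sl_solution_def
proof (intro ballI conjI)
  fix x assume x: "x \<in> {0..T}"
  note deriv = sl_solutionD[OF assms(1) x] sl_solutionD[OF assms(2) x]
  show "((\<lambda>x. a * y x + b * z x) has_vector_derivative a * u x + b * v x) (at x within {0..T})"
    by (intro derivative_intros deriv)
  have "((\<lambda>x. a * u x + b * v x) has_vector_derivative a * (Q x * y x) + b * (Q x * z x))
      (at x within {0..T})"
    by (intro derivative_intros deriv)
  then show "((\<lambda>x. a * u x + b * v x) has_vector_derivative Q x * (a * y x + b * z x))
      (at x within {0..T})"
    by (simp add: algebra_simps)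
qed

lemma sl_solution_reflect:
  assumes "sl_solution T Q y u"
  shows "sl_solution T (\<lambda>x. Q (T - x)) (\<lambda>x. y (T - x)) (\<lambda>x. - u (T - x))"
  unfolding sl_solution_def
proof (intro ballI conjI)
  fix x assume "x \<in> {0..T}"
  then have x: "T - x \<in> {0..T}" by auto
  have refl: "((\<lambda>x. T - x) has_vector_derivative - 1) (at x within {0..T})"
    by (auto intro!: derivative_eq_intros)
  have chain: "((\<lambda>x. f (T - x)) has_vector_derivative - d) (at x within {0..T})"
    if "(f has_vector_derivative d) (at (T - x) within {0..T})" for f :: "real \<Rightarrow> complex" and d
  proof -
    have "(f has_vector_derivative d) (at (T - x) within (\<lambda>x. T - x) ` {0..T})"
      using that by simp
    from vector_diff_chain_within[OF refl this] show ?thesis by (simp add: o_def)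
  qed
  show "((\<lambda>x. y (T - x)) has_vector_derivative - u (T - x)) (at x within {0..T})"
    by (rule chain[OF sl_solutionD(1)[OF assms x]])
  show "((\<lambda>x. - u (T - x)) has_vector_derivative Q (T - x) * y (T - x)) (at x within {0..T})"
    using has_vector_derivative_minus[OF chain[OF sl_solutionD(2)[OF assms x]]] by simp
qed

lemma sl_solution_cnj:
  assumes "sl_solution T Q y u"
  shows "sl_solution T (\<lambda>x. cnj (Q x)) (\<lambda>x. cnj (y x)) (\<lambda>x. cnj (u x))"
  unfolding sl_solution_def
proof (intro ballI conjI)
  fix x assume x: "x \<in> {0..T}"
  show "((\<lambda>x. cnj (y x)) has_vector_derivative cnj (u x)) (at x within {0..T})"
    by (rule has_vector_derivative_cnj[OF sl_solutionD(1)[OF assms x]])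
  show "((\<lambda>x. cnj (u x)) has_vector_derivative cnj (Q x) * cnj (y x)) (at x within {0..T})"
    using has_vector_derivative_cnj[OF sl_solutionD(2)[OF assms x]] by simp
qed

lemma sl_solution_green:
  assumes y: "sl_solution T Q y u" and z: "sl_solution T R z v" and x: "x \<in> {0..T}"
  shows "((\<lambda>t. (R t - Q t) * (y t * z t)) has_integral
      (y x * v x - u x * z x) - (y 0 * v 0 - u 0 * z 0)) {0..x}"
proof (rule fundamental_theorem_of_calculus)
  fix t assume "t \<in> {0..x}"
  then have t: "t \<in> {0..T}" and sub: "{0..x} \<subseteq> {0..T}" using x by auto
  have "((\<lambda>x. y x * v x - u x * z x) has_vector_derivative
     (y t * (R t * z t) + u t * v t) - (u t * v t + Q t * y t * z t)) (at t within {0..T})"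
    by (intro derivative_intros sl_solutionD[OF y t] sl_solutionD[OF z t])
  then show "((\<lambda>x. y x * v x - u x * z x) has_vector_derivative (R t - Q t) * (y t * z t))
      (at t within {0..x})"
    by (rule has_vector_derivative_within_subset[OF _ sub, THEN has_vector_derivative_eq_rhs])
      (simp add: algebra_simps)
qed (use x in auto)

definition sl_field :: "(real \<Rightarrow> complex) \<Rightarrow> real \<Rightarrow> complex \<times> complex \<Rightarrow> complex \<times> complex" where
  "sl_field Q t = (\<lambda>(y, u). (u, Q t * y))"

lemma sl_solution_iff_sl_field:
  "sl_solution T Q y u \<longleftrightarrow> (\<forall>t\<in>{0..T}.
     ((\<lambda>t. (y t, u t)) has_vector_derivative sl_field Q t (y t, u t)) (at t within {0..T}))"
proof -
  have "((\<lambda>t. (y t, u t)) has_vector_derivative (y', u')) (at t within S) \<longleftrightarrow>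
      (y has_vector_derivative y') (at t within S) \<and>
      (u has_vector_derivative u') (at t within S)" for y' u' t S
    using bounded_linear.has_vector_derivative[OF bounded_linear_fst,
        of "\<lambda>t. (y t, u t)" "(y', u')"]
      bounded_linear.has_vector_derivative[OF bounded_linear_snd,
        of "\<lambda>t. (y t, u t)" "(y', u')"]
    by (auto intro: has_vector_derivative_Pair)
  then show ?thesis by (simp add: sl_solution_def sl_field_def)
qed

lemma lipschitz_on_sl_field:
  assumes "norm (Q t) \<le> M"
  shows "(1 + M)-lipschitz_on UNIV (sl_field Q t)"
proof (rule lipschitz_onI)
  fix z w :: "complex \<times> complex"
  obtain y u where d: "z - w = (y, u)" by (cases "z - w")
  have "norm (sl_field Q t (y, u)) \<le> norm u + norm (Q t) * norm y"
    using norm_Pair_le[of u "Q t * y"] by (simp add: sl_field_def norm_mult)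
  also have "\<dots> \<le> norm (z - w) + M * norm (z - w)"
    unfolding d using assms
    by (intro add_mono mult_mono norm_fst_le norm_snd_le) (auto intro: order_trans[OF norm_ge_zero])
  finally show "dist (sl_field Q t z) (sl_field Q t w) \<le> (1 + M) * dist z w"
    unfolding dist_norm d[symmetric] by (simp add: sl_field_def case_prod_beta algebra_simps)
qed (use order_trans[OF norm_ge_zero assms] in simp)

lemma sl_solution_perturbation:
  assumes y: "sl_solution T Q y u" and z: "sl_solution T R z v" and init: "y 0 = z 0" "u 0 = v 0"
    and Q: "\<And>t. t \<in> {0..T} \<Longrightarrow> norm (Q t) \<le> M"
    and diff: "\<And>t. t \<in> {0..T} \<Longrightarrow> norm ((Q t - R t) * z t) \<le> \<epsilon>" and x: "x \<in> {0..T}"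
  shows "norm (y x - z x) \<le> \<epsilon> * T * exp ((1 + M) * x)"
    and "norm (u x - v x) \<le> \<epsilon> * T * exp ((1 + M) * x)"
proof -
  have "norm ((y x, u x) - (z x, v x))
      \<le> (norm ((y 0, u 0) - (z 0, v 0)) + \<epsilon> * (T - 0)) * exp ((1 + M) * (x - 0))"
  proof (rule lipschitz_ode_perturbation[where f = "sl_field Q"
        and w = "\<lambda>t. sl_field R t (z t, v t)"])
    show "norm (sl_field Q t (z t, v t) - sl_field R t (z t, v t)) \<le> \<epsilon>" if "t \<in> {0..T}" for t
      using diff[OF that] by (simp add: sl_field_def norm_Pair left_diff_distrib)
    show "(1 + M)-lipschitz_on UNIV (sl_field Q t)" if "t \<in> {0..T}" for t
      using Q[OF that] by (rule lipschitz_on_sl_field)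
  qed (use y z x in \<open>simp_all add: sl_solution_iff_sl_field\<close>)
  then show "norm (y x - z x) \<le> \<epsilon> * T * exp ((1 + M) * x)"
    "norm (u x - v x) \<le> \<epsilon> * T * exp ((1 + M) * x)"
    using norm_fst_le[of "y x - z x" "u x - v x"] norm_snd_le[of "u x - v x" "y x - z x"] init
    by (simp_all add: zero_prod_def)
qed

lemma sl_solution_unique:
  assumes y: "sl_solution T Q y u" and z: "sl_solution T Q z v" and Q: "continuous_on {0..T} Q"
    and init: "y 0 = z 0" "u 0 = v 0" and x: "x \<in> {0..T}"
  shows "y x = z x" "u x = v x"
proof -
  obtain M where M: "\<And>t. t \<in> {0..T} \<Longrightarrow> norm (Q t) \<le> M"
    using continuous_on_Icc_bound[OF Q] by metis
  show "y x = z x" "u x = v x"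
    using sl_solution_perturbation[OF y z init M, of 0 x] x by auto
qed

lemma sl_solution_exists:
  assumes T: "0 \<le> T" and Q: "continuous_on {0..T} Q"
  obtains y u where "sl_solution T Q y u" "y 0 = a" "u 0 = b"
proof -
  obtain M where M: "\<And>t. t \<in> {0..T} \<Longrightarrow> norm (Q t) \<le> M"
    using continuous_on_Icc_bound[OF Q] by metis
  have cont: "continuous_on ({0..T} \<times> UNIV) (\<lambda>(t, z). sl_field Q t z)"
    unfolding sl_field_def case_prod_beta
    by (intro continuous_intros continuous_on_compose2[OF Q, of _ fst]) auto
  have lip: "(1 + M)-lipschitz_on UNIV (sl_field Q t)" if "t \<in> {0..T}" for t
    using M[OF that] by (rule lipschitz_on_sl_field)
  obtain z where "z 0 = (a, b)"
    "\<And>t. t \<in> {0..T} \<Longrightarrow> (z has_vector_derivative sl_field Q t (z t)) (at t within {0..T})"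
    using lipschitz_ode_exists[OF T cont lip, of "(a, b)"] by blast
  then have "sl_solution T Q (\<lambda>t. fst (z t)) (\<lambda>t. snd (z t))" "fst (z 0) = a" "snd (z 0) = b"
    by (auto simp: sl_solution_iff_sl_field)
  then show ?thesis by (rule that)
qed

section \<open>Dependence on the spectral parameter\<close>

locale sturm_liouville =
  fixes T :: real and p :: "real \<Rightarrow> complex"
  assumes length_pos: "0 < T" and continuous_potential: "continuous_on {0..T} p"
begin

definition sol_pair :: "complex \<Rightarrow> complex \<Rightarrow> complex \<Rightarrow> (real \<Rightarrow> complex) \<times> (real \<Rightarrow> complex)" where
  "sol_pair a b l = (SOME (y, u). sl_solution T (\<lambda>x. p x - l) y u \<and> y 0 = a \<and> u 0 = b)"

definition sol :: "complex \<Rightarrow> complex \<Rightarrow> complex \<Rightarrow> real \<Rightarrow> complex" where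
  "sol a b l = fst (sol_pair a b l)"

definition dsol :: "complex \<Rightarrow> complex \<Rightarrow> complex \<Rightarrow> real \<Rightarrow> complex" where
  "dsol a b l = snd (sol_pair a b l)"

lemma continuous_on_potential_minus: "continuous_on {0..T} (\<lambda>x. p x - l)"
  by (intro continuous_intros continuous_potential)

lemma sl_solution_sol: "sl_solution T (\<lambda>x. p x - l) (sol a b l) (dsol a b l)"
  and sol_0 [simp]: "sol a b l 0 = a"
  and dsol_0 [simp]: "dsol a b l 0 = b"
proof -
  obtain y u where "sl_solution T (\<lambda>x. p x - l) y u" "y 0 = a" "u 0 = b"
    using sl_solution_exists[OF less_imp_le[OF length_pos] continuous_on_potential_minus] by blast
  then have "\<exists>yu. case yu of (y, u) \<Rightarrow> sl_solution T (\<lambda>x. p x - l) y u \<and> y 0 = a \<and> u 0 = b"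
    by auto
  from someI_ex[OF this]
  have "case sol_pair a b l of (y, u) \<Rightarrow> sl_solution T (\<lambda>x. p x - l) y u \<and> y 0 = a \<and> u 0 = b"
    unfolding sol_pair_def .
  then show "sl_solution T (\<lambda>x. p x - l) (sol a b l) (dsol a b l)"
    "sol a b l 0 = a" "dsol a b l 0 = b"
    by (simp_all add: sol_def dsol_def case_prod_beta)
qed

lemmas continuous_on_sol = sl_solution_continuous_on(1)[OF sl_solution_sol]

lemma sl_solution_eq_sol:
  assumes "sl_solution T (\<lambda>x. p x - l) y u" "x \<in> {0..T}"
  shows "y x = sol (y 0) (u 0) l x" "u x = dsol (y 0) (u 0) l x"
  using sl_solution_unique[OF assms(1) sl_solution_sol continuous_on_potential_minus _ _ assms(2)]
  by auto

lemma sol_wronskian: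
  assumes x: "x \<in> {0..T}"
  shows "sol a b l x * dsol c d m x - dsol a b l x * sol c d m x
           = a * d - b * c + (l - m) * integral {0..x} (\<lambda>t. sol a b l t * sol c d m t)"
proof -
  have "((\<lambda>t. (l - m) * (sol a b l t * sol c d m t)) has_integral
      (sol a b l x * dsol c d m x - dsol a b l x * sol c d m x) - (a * d - b * c)) {0..x}"
    using sl_solution_green[OF sl_solution_sol[of l a b] sl_solution_sol[of m c d] x] by simp
  then have "(l - m) * integral {0..x} (\<lambda>t. sol a b l t * sol c d m t)
      = (sol a b l x * dsol c d m x - dsol a b l x * sol c d m x) - (a * d - b * c)"
    by (simp add: integral_unique flip: integral_mult_right)
  then show ?thesis by simp
qed

lemma sol_eq_0_imp:
  assumes x: "x \<in> {0<..T}" and zero: "\<And>t. t \<in> {0..x} \<Longrightarrow> sol a b l t = 0"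
  shows "(a, b) = (0, 0)"
proof -
  have "(sol a b l has_vector_derivative b) (at 0 within {0..x})"
    using sl_solutionD(1)[OF sl_solution_sol, of 0 a b l] x
    by (auto elim: has_vector_derivative_within_subset)
  from has_vector_derivative_Icc_eq[OF this has_vector_derivative_const zero] have "b = 0"
    using x by simp
  moreover have "a = 0" using zero[of 0] x by simp
  ultimately show ?thesis by simp
qed

lemma sol_scale:
  assumes x: "x \<in> {0..T}"
  shows "sol (c * a) (c * b) l x = c * sol a b l x" "dsol (c * a) (c * b) l x = c * dsol a b l x"
  using sl_solution_eq_sol[OF sl_solution_lincomb[OF sl_solution_sol sl_solution_sol] x,
      of c a b l 0 0 0] by simp_all

lemma uniform_limit_sol: "uniform_limit {0..T} (sol a b) (sol a b m) (at m)"
proof -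
  obtain P where P0: "0 < P" and P: "\<And>t. t \<in> {0..T} \<Longrightarrow> norm (p t) \<le> P"
    using continuous_on_Icc_bound[OF continuous_potential] by metis
  obtain N where N0: "0 < N" and N: "\<And>t. t \<in> {0..T} \<Longrightarrow> norm (sol a b m t) \<le> N"
    using continuous_on_Icc_bound[OF continuous_on_sol] by metis
  define M where "M = P + (norm m + 1)"
  define C where "C = N * T * exp ((1 + M) * T)"
  have M0: "0 \<le> M" using P0 by (simp add: M_def)
  have lipschitz: "dist (sol a b l x) (sol a b m x) \<le> norm (l - m) * C"
    if l: "l \<in> ball m 1" and x: "x \<in> {0..T}" for l x
  proof -
    have l_le: "norm l \<le> norm m + 1"
      using l norm_triangle_ineq2[of l m] by (simp add: dist_norm norm_minus_commute)
    have "norm (sol a b l x - sol a b m x) \<le> (norm (l - m) * N) * T * exp ((1 + M) * x)"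
    proof (rule sl_solution_perturbation(1)[OF sl_solution_sol sl_solution_sol _ _ _ _ x])
      fix t assume t: "t \<in> {0..T}"
      show "norm (p t - l) \<le> M"
        using P[OF t] l_le norm_triangle_ineq4[of "p t" l] by (simp add: M_def)
      have "norm ((m - l) * sol a b m t) \<le> norm (l - m) * N"
        unfolding norm_mult norm_minus_commute[of m l] by (intro mult_left_mono N t) auto
      then show "norm ((p t - l - (p t - m)) * sol a b m t) \<le> norm (l - m) * N" by simp
    qed simp_all
    also have "\<dots> \<le> (norm (l - m) * N) * T * exp ((1 + M) * T)"
      using x M0 N0 length_pos by (intro mult_left_mono) auto
    finally show ?thesis by (simp add: C_def dist_norm mult_ac)
  qed
  show ?thesis
  proof (rule uniform_limitI)
    fix e :: real assume e: "0 < e"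
    have "((\<lambda>l. norm (l - m) * C) \<longlongrightarrow> 0) (at m)"
      by (rule tendsto_eq_intros refl | simp)+
    then have "\<forall>\<^sub>F l in at m. norm (l - m) * C < e" using e by (rule order_tendstoD)
    moreover have "\<forall>\<^sub>F l in at m. l \<in> ball m 1" by (rule eventually_at_in_open') auto
    ultimately show "\<forall>\<^sub>F l in at m. \<forall>x\<in>{0..T}. dist (sol a b l x) (sol a b m x) < e"
      by eventually_elim (use lipschitz le_less_trans in blast)
  qed
qed

lemma isCont_integral_sol:
  assumes x: "x \<in> {0..T}" and g: "continuous_on {0..T} g"
  shows "isCont (\<lambda>l. integral {0..x} (\<lambda>t. sol a b l t * g t)) m"
proof -
  have sub: "{0..x} \<subseteq> {0..T}" using x by auto
  note continuous = continuous_on_subset[OF continuous_on_sol sub] continuous_on_subset[OF g sub]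
  have "uniform_limit {0..x} (\<lambda>l t. sol a b l t * g t) (\<lambda>t. sol a b m t * g t) (at m)"
    by (intro uniform_lim_mult uniform_limit_on_subset[OF uniform_limit_sol sub] uniform_limit_const
        compact_imp_bounded compact_continuous_image continuous compact_Icc)
  then obtain I J where I: "\<And>l. ((\<lambda>t. sol a b l t * g t) has_integral I l) {0..x}"
    and J: "((\<lambda>t. sol a b m t * g t) has_integral J) {0..x}" and lim: "(I \<longlongrightarrow> J) (at m)"
    by (rule uniform_limit_integral) (auto intro!: continuous_intros continuous)
  have "J = I m" by (rule has_integral_unique[OF J I])
  with lim show ?thesis by (simp add: isCont_def integral_unique[OF I])
qed

lemma sol_variation_of_constants:
  assumes x: "x \<in> {0..T}"
  shows "sol a b l x - sol a b m x =
         (sol 1 0 m x * integral {0..x} (\<lambda>t. sol a b l t * sol 0 1 m t)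
           - sol 0 1 m x * integral {0..x} (\<lambda>t. sol a b l t * sol 1 0 m t)) * (l - m)"
    and "dsol a b l x - dsol a b m x =
         (dsol 1 0 m x * integral {0..x} (\<lambda>t. sol a b l t * sol 0 1 m t)
           - dsol 0 1 m x * integral {0..x} (\<lambda>t. sol a b l t * sol 1 0 m t)) * (l - m)"
proof -
  note W = sol_wronskian[OF x, of a b l 0 1 m] sol_wronskian[OF x, of a b l 1 0 m]
    sol_wronskian[OF x, of a b m 0 1 m] sol_wronskian[OF x, of a b m 1 0 m]
    sol_wronskian[OF x, of 1 0 m 0 1 m]
  show "sol a b l x - sol a b m x =
         (sol 1 0 m x * integral {0..x} (\<lambda>t. sol a b l t * sol 0 1 m t)
           - sol 0 1 m x * integral {0..x} (\<lambda>t. sol a b l t * sol 1 0 m t)) * (l - m)"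
    using W by algebra
  show "dsol a b l x - dsol a b m x =
         (dsol 1 0 m x * integral {0..x} (\<lambda>t. sol a b l t * sol 0 1 m t)
           - dsol 0 1 m x * integral {0..x} (\<lambda>t. sol a b l t * sol 1 0 m t)) * (l - m)"
    using W by algebra
qed

lemma sol_holomorphic_on:
  assumes x: "x \<in> {0..T}"
  shows "(\<lambda>l. sol a b l x) holomorphic_on A" "(\<lambda>l. dsol a b l x) holomorphic_on A"
proof -
  note cont = isCont_integral_sol[OF x continuous_on_sol]
  have "(\<lambda>l. sol a b l x) field_differentiable at m" for m
    unfolding field_differentiable_def CARAT_DERIV
    by (rule exI)+ (auto intro!: sol_variation_of_constants(1)[OF x] continuous_intros cont)
  then show "(\<lambda>l. sol a b l x) holomorphic_on A"
    by (simp add: holomorphic_on_def field_differentiable_at_within)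
  have "(\<lambda>l. dsol a b l x) field_differentiable at m" for m
    unfolding field_differentiable_def CARAT_DERIV
    by (rule exI)+ (auto intro!: sol_variation_of_constants(2)[OF x] continuous_intros cont)
  then show "(\<lambda>l. dsol a b l x) holomorphic_on A"
    by (simp add: holomorphic_on_def field_differentiable_at_within)
qed

end

section \<open>Asymptotics in the spectral parameter\<close>

lemma norm_cos_mult_of_real_le: "0 \<le> x \<Longrightarrow> norm (cos (k * of_real x)) \<le> exp (\<bar>Im k\<bar> * x)"
  using cmod_cos_le_exp[of 1 "k * of_real x"] by (simp add: abs_mult)

lemma norm_sin_mult_of_real_le: "0 \<le> x \<Longrightarrow> norm (sin (k * of_real x)) \<le> exp (\<bar>Im k\<bar> * x)"
  using cmod_sin_le_exp[of 1 "k * of_real x"] by (simp add: abs_mult)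

lemma sl_solution_free:
  assumes "k \<noteq> 0"
  shows "sl_solution T (\<lambda>_. - (k\<^sup>2)) (\<lambda>t. sin (k * (x - of_real t)) / k)
      (\<lambda>t. - cos (k * (x - of_real t)))"
    and "sl_solution T (\<lambda>_. - (k\<^sup>2)) (\<lambda>t. cos (k * (x - of_real t)))
        (\<lambda>t. k * sin (k * (x - of_real t)))"
  unfolding sl_solution_def using assms
  by (auto intro!: has_vector_derivative_real_field derivative_eq_intros simp: power2_eq_square)

lemma sl_solution_volterra:
  assumes y: "sl_solution T (\<lambda>x. p x - k\<^sup>2) y u" and k: "k \<noteq> 0" and x: "x \<in> {0..T}"
  shows "((\<lambda>t. p t * y t * (sin (k * (of_real x - of_real t)) / k)) has_integral
      y x - (y 0 * cos (k * of_real x) + u 0 * (sin (k * of_real x) / k))) {0..x}"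
    and "((\<lambda>t. p t * y t * cos (k * (of_real x - of_real t))) has_integral
      u x - (u 0 * cos (k * of_real x) - y 0 * (k * sin (k * of_real x)))) {0..x}"
  using sl_solution_green[OF y sl_solution_free(1)[OF k] x, THEN has_integral_neg, of "of_real x"]
    sl_solution_green[OF y sl_solution_free(2)[OF k] x, THEN has_integral_neg, of "of_real x"]
  by (simp_all add: algebra_simps)

lemma sl_solution_volterra_norm_le:
  assumes y: "sl_solution T (\<lambda>x. p x - k\<^sup>2) y u" and p: "\<And>t. t \<in> {0..T} \<Longrightarrow> norm (p t) \<le> P"
    and k: "k \<noteq> 0" and x: "x \<in> {0..T}"
  shows "norm (y x - (y 0 * cos (k * of_real x) + u 0 * (sin (k * of_real x) / k)))
      \<le> exp (\<bar>Im k\<bar> * x) * (P / norm k * integral {0..x} (\<lambda>t. exp (- \<bar>Im k\<bar> * t) * norm (y t)))"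
    and "norm (u x - (u 0 * cos (k * of_real x) - y 0 * (k * sin (k * of_real x))))
      \<le> exp (\<bar>Im k\<bar> * x) * (P * integral {0..x} (\<lambda>t. exp (- \<bar>Im k\<bar> * t) * norm (y t)))"
proof -
  define g where "g t = exp (- \<bar>Im k\<bar> * t) * norm (y t)" for t
  have g: "continuous_on {0..x} g"
    unfolding g_def using x
    by (intro continuous_intros continuous_on_subset[OF sl_solution_continuous_on(1)[OF y]]) auto
  have P: "0 \<le> P" using order_trans[OF norm_ge_zero p[of 0]] x by auto
  have dominating: "((\<lambda>t. exp (\<bar>Im k\<bar> * x) * (c * g t)) has_integral
      exp (\<bar>Im k\<bar> * x) * (c * integral {0..x} g)) {0..x}" for c
    by (intro has_integral_mult_right integrable_integral integrable_continuous_interval g)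
  have trig: "norm (cos (k * (of_real x - of_real t))) \<le> exp (\<bar>Im k\<bar> * (x - t))"
      "norm (sin (k * (of_real x - of_real t))) \<le> exp (\<bar>Im k\<bar> * (x - t))" if "t \<in> {0..x}" for t
    using norm_cos_mult_of_real_le[of "x - t" k] norm_sin_mult_of_real_le[of "x - t" k] that
    by simp_all
  have integrand: "norm (p t * y t * w) \<le> exp (\<bar>Im k\<bar> * x) * (P * c * g t)"
    if t: "t \<in> {0..x}" and w: "norm w \<le> c * exp (\<bar>Im k\<bar> * (x - t))" for t w c
  proof -
    have "norm (p t * y t * w) \<le> P * norm (y t) * (c * exp (\<bar>Im k\<bar> * (x - t)))"
      unfolding norm_mult using t x P w by (intro mult_mono p) auto
    also have "\<dots> = exp (\<bar>Im k\<bar> * x) * (P * c * g t)"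
      by (simp add: g_def right_diff_distrib exp_diff exp_minus divide_inverse)
    finally show ?thesis .
  qed
  have "norm (p t * y t * (sin (k * (of_real x - of_real t)) / k))
      \<le> exp (\<bar>Im k\<bar> * x) * (P / norm k * g t)"
    if "t \<in> {0..x}" for t
    using integrand[OF that, of "sin (k * (of_real x - of_real t)) / k" "1 / norm k"]
      trig(2)[OF that]
    by (simp add: norm_divide divide_right_mono)
  then show "norm (y x - (y 0 * cos (k * of_real x) + u 0 * (sin (k * of_real x) / k)))
      \<le> exp (\<bar>Im k\<bar> * x) * (P / norm k * integral {0..x} (\<lambda>t. exp (- \<bar>Im k\<bar> * t) * norm (y t)))"
    unfolding g_def[symmetric]
    by (rule norm_has_integral_le[OF sl_solution_volterra(1)[OF y k x] dominating])
  have "norm (p t * y t * cos (k * (of_real x - of_real t))) \<le> exp (\<bar>Im k\<bar> * x) * (P * g t)"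
    if "t \<in> {0..x}" for t
    using integrand[OF that, of "cos (k * (of_real x - of_real t))" 1] trig(1)[OF that] by simp
  then show "norm (u x - (u 0 * cos (k * of_real x) - y 0 * (k * sin (k * of_real x))))
      \<le> exp (\<bar>Im k\<bar> * x) * (P * integral {0..x} (\<lambda>t. exp (- \<bar>Im k\<bar> * t) * norm (y t)))"
    unfolding g_def[symmetric]
    by (rule norm_has_integral_le[OF sl_solution_volterra(2)[OF y k x] dominating])
qed

lemma sl_solution_norm_le:
  assumes y: "sl_solution T (\<lambda>x. p x - k\<^sup>2) y u" and p: "\<And>t. t \<in> {0..T} \<Longrightarrow> norm (p t) \<le> P"
    and k: "k \<noteq> 0" and x: "x \<in> {0..T}"
  shows "norm (y x) \<le> (norm (y 0) + norm (u 0) / norm k) * exp (P / norm k * x) * exp (\<bar>Im k\<bar> * x)"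
proof -
  define g where "g t = exp (- \<bar>Im k\<bar> * t) * norm (y t)" for t
  define A where "A = norm (y 0) + norm (u 0) / norm k"
  have g: "continuous_on {0..T} g"
    unfolding g_def by (intro continuous_intros sl_solution_continuous_on[OF y])
  have P: "0 \<le> P" using order_trans[OF norm_ge_zero p[of 0]] x by auto
  have "g x \<le> A * exp (P / norm k * (x - 0))"
  proof (rule gronwall[OF g _ _ x])
    fix s assume s: "s \<in> {0..T}"
    let ?free = "y 0 * cos (k * of_real s) + u 0 * (sin (k * of_real s) / k)"
    have s0: "0 \<le> s" using s by simp
    have "norm ?free \<le> norm (y 0) * norm (cos (k * of_real s))
        + norm (u 0) * (norm (sin (k * of_real s)) / norm k)"
      by (rule norm_triangle_mono) (simp_all add: norm_mult norm_divide)
    also have "\<dots> \<le> norm (y 0) * exp (\<bar>Im k\<bar> * s) + norm (u 0) * (exp (\<bar>Im k\<bar> * s) / norm k)"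
      by (intro add_mono mult_left_mono divide_right_mono norm_cos_mult_of_real_le[OF s0]
          norm_sin_mult_of_real_le[OF s0] norm_ge_zero)
    also have "\<dots> = A * exp (\<bar>Im k\<bar> * s)" by (simp add: A_def algebra_simps)
    finally have "norm (y s) \<le> A * exp (\<bar>Im k\<bar> * s)
        + exp (\<bar>Im k\<bar> * s) * (P / norm k * integral {0..s} g)"
      using sl_solution_volterra_norm_le(1)[OF y p k s, folded g_def]
        norm_triangle_sub[of "y s" ?free]
      by linarith
    then show "g s \<le> A + P / norm k * integral {0..s} g"
      by (simp add: g_def exp_minus field_simps)
  qed (use P in auto)
  then show ?thesis by (simp add: g_def A_def exp_minus field_simps)
qed

lemma sl_solution_deriv_asymptotics:
  assumes y: "sl_solution T (\<lambda>x. p x - k\<^sup>2) y u" and p: "\<And>t. t \<in> {0..T} \<Longrightarrow> norm (p t) \<le> P"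
    and k: "k \<noteq> 0" and x: "x \<in> {0..T}"
  shows "norm (u x - (u 0 * cos (k * of_real x) - y 0 * (k * sin (k * of_real x))))
    \<le> P * x * ((norm (y 0) + norm (u 0) / norm k) * exp (P / norm k * x) * exp (\<bar>Im k\<bar> * x))"
proof -
  define A where "A = norm (y 0) + norm (u 0) / norm k"
  have A: "0 \<le> A" by (simp add: A_def)
  have P: "0 \<le> P" using order_trans[OF norm_ge_zero p[of 0]] x by auto
  have "integral {0..x} (\<lambda>t. exp (- \<bar>Im k\<bar> * t) * norm (y t))
      \<le> integral {0..x} (\<lambda>t. A * exp (P / norm k * x))"
  proof (rule integral_le)
    fix t assume t: "t \<in> {0..x}"
    have "norm (y t) \<le> A * exp (P / norm k * t) * exp (\<bar>Im k\<bar> * t)"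
      unfolding A_def by (rule sl_solution_norm_le[OF y p k]) (use t x in auto)
    then have "exp (- \<bar>Im k\<bar> * t) * norm (y t) \<le> A * exp (P / norm k * t)"
      by (simp add: exp_minus field_simps)
    also have "\<dots> \<le> A * exp (P / norm k * x)"
      using t A P by (auto intro!: mult_left_mono divide_right_mono)
    finally show "exp (- \<bar>Im k\<bar> * t) * norm (y t) \<le> A * exp (P / norm k * x)" .
  qed (use x in \<open>auto intro!: integrable_continuous_interval continuous_intros
      continuous_on_subset[OF sl_solution_continuous_on(1)[OF y]]\<close>)
  also have "\<dots> = A * exp (P / norm k * x) * x" using x by simp
  finally have "exp (\<bar>Im k\<bar> * x) * (P * integral {0..x} (\<lambda>t. exp (- \<bar>Im k\<bar> * t) * norm (y t)))
      \<le> exp (\<bar>Im k\<bar> * x) * (P * (A * exp (P / norm k * x) * x))"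
    using P by (intro mult_left_mono) auto
  then show ?thesis
    using sl_solution_volterra_norm_le(2)[OF y p k x] by (simp add: A_def mult_ac)
qed

definition exp_type :: "real \<Rightarrow> complex \<Rightarrow> complex" where
  "exp_type x k = of_real (exp (\<bar>Im k\<bar> * x))"

lemma exp_type_nonzero [simp]: "exp_type x k \<noteq> 0"
  by (simp add: exp_type_def)

lemma exp_type_mult: "exp_type x k * exp_type y k = exp_type (x + y) k"
  by (simp add: exp_type_def distrib_left exp_add)

context sturm_liouville
begin

lemma sol_exp_type_bound:
  obtains C where
    "\<And>a b k x. 1 \<le> norm k \<Longrightarrow> x \<in> {0..T} \<Longrightarrow>
       norm (sol a b (k\<^sup>2) x) \<le> C * ((norm a + norm b / norm k) * norm (exp_type x k))"
    "\<And>a b k x. 1 \<le> norm k \<Longrightarrow> x \<in> {0..T} \<Longrightarrow>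
       norm (dsol a b (k\<^sup>2) x - (b * cos (k * of_real x) - a * (k * sin (k * of_real x))))
         \<le> C * ((norm a + norm b / norm k) * norm (exp_type x k))"
proof -
  obtain P where P: "0 < P" and p: "\<And>t. t \<in> {0..T} \<Longrightarrow> norm (p t) \<le> P"
    using continuous_on_Icc_bound[OF continuous_potential] by metis
  show ?thesis
  proof (rule that[of "(1 + P * T) * exp (P * T)"])
    fix a b k :: complex and x assume k: "1 \<le> norm k" and x: "x \<in> {0..T}"
    let ?A = "(norm a + norm b / norm k) * exp (P / norm k * x) * exp (\<bar>Im k\<bar> * x)"
    let ?B = "(norm a + norm b / norm k) * norm (exp_type x k)"
    have k0: "k \<noteq> 0" and Px: "P * x \<le> 1 + P * T"
      using P x k by (auto intro: add_increasing)
    have "P / norm k * x \<le> P * T"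
      using P k x by (intro mult_mono) (auto simp: divide_le_eq mult_le_cancel_left1)
    then have "?A \<le> (norm a + norm b / norm k) * exp (P * T) * exp (\<bar>Im k\<bar> * x)"
      by (intro mult_right_mono mult_left_mono) auto
    then have "?A \<le> exp (P * T) * ?B" by (simp add: exp_type_def mult_ac)
    then have scaled: "c * ?A \<le> (1 + P * T) * exp (P * T) * ?B" if "c \<le> 1 + P * T" for c
      using mult_mono[OF that, of ?A "exp (P * T) * ?B"] P length_pos by (simp add: mult.assoc)
    show "norm (sol a b (k\<^sup>2) x) \<le> (1 + P * T) * exp (P * T) * ?B"
      using sl_solution_norm_le[OF sl_solution_sol p k0 x, of a b] scaled[of 1] P length_pos by simp
    show "norm (dsol a b (k\<^sup>2) x - (b * cos (k * of_real x) - a * (k * sin (k * of_real x))))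
        \<le> (1 + P * T) * exp (P * T) * ?B"
      using sl_solution_deriv_asymptotics[OF sl_solution_sol p k0 x, of a b] scaled[OF Px] by simp
  qed
qed

lemma sol_bigo_exp_type:
  assumes x: "x \<in> {0..T}"
  shows "(\<lambda>k. sol a b (k\<^sup>2) x) \<in> O[at_infinity](exp_type x)"
proof -
  obtain C where C: "\<And>a b k x. 1 \<le> norm k \<Longrightarrow> x \<in> {0..T} \<Longrightarrow>
       norm (sol a b (k\<^sup>2) x) \<le> C * ((norm a + norm b / norm k) * norm (exp_type x k))"
    using sol_exp_type_bound by metis
  have "norm (sol a b (k\<^sup>2) x) \<le> \<bar>C\<bar> * (norm a + norm b) * norm (exp_type x k)"
    if k: "1 \<le> norm k" for k
  proof -
    have "norm b / norm k \<le> norm b" using k by (simp add: divide_le_eq mult_le_cancel_left1)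
    then show ?thesis
      unfolding mult.assoc
      by (intro order_trans[OF C[OF k x]] mult_mono mult_right_mono add_left_mono) auto
  qed
  then show ?thesis by (intro bigoI) (auto simp: eventually_at_infinity)
qed

definition char_fun :: "complex \<Rightarrow> complex \<Rightarrow> complex \<Rightarrow> complex \<Rightarrow> complex" where
  "char_fun H a b l = dsol a b l T + H * sol a b l T"

lemma end_mem: "T \<in> {0..T}"
  using length_pos by simp

lemma char_fun_holomorphic_on: "char_fun H a b holomorphic_on A"
  unfolding char_fun_def by (intro holomorphic_intros sol_holomorphic_on end_mem)

lemma char_fun_exp_type_bound:
  obtains C where "\<And>a b k. 1 \<le> norm k \<Longrightarrow>
    norm (char_fun H a b (k\<^sup>2) - (b * cos (k * of_real T) - a * (k * sin (k * of_real T))))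
      \<le> C * ((norm a + norm b / norm k) * norm (exp_type T k))"
proof -
  obtain C where bounds: "\<And>a b k x. 1 \<le> norm k \<Longrightarrow> x \<in> {0..T} \<Longrightarrow>
       norm (sol a b (k\<^sup>2) x) \<le> C * ((norm a + norm b / norm k) * norm (exp_type x k))"
    "\<And>a b k x. 1 \<le> norm k \<Longrightarrow> x \<in> {0..T} \<Longrightarrow>
       norm (dsol a b (k\<^sup>2) x - (b * cos (k * of_real x) - a * (k * sin (k * of_real x))))
         \<le> C * ((norm a + norm b / norm k) * norm (exp_type x k))"
    using sol_exp_type_bound by metis
  show ?thesis
  proof (rule that[of "C + norm H * C"])
    fix a b k :: complex assume k: "1 \<le> norm k"
    let ?free = "b * cos (k * of_real T) - a * (k * sin (k * of_real T))"
    have "norm (char_fun H a b (k\<^sup>2) - ?free)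
        \<le> norm (dsol a b (k\<^sup>2) T - ?free) + norm H * norm (sol a b (k\<^sup>2) T)"
      unfolding char_fun_def norm_mult[symmetric] add_diff_eq[symmetric]
      by (rule order_trans[OF _ norm_triangle_ineq]) (simp add: algebra_simps)
    also have "\<dots> \<le> C * ((norm a + norm b / norm k) * norm (exp_type T k))
        + norm H * (C * ((norm a + norm b / norm k) * norm (exp_type T k)))"
      by (intro add_mono mult_left_mono bounds k end_mem norm_ge_zero)
    finally show "norm (char_fun H a b (k\<^sup>2) - ?free)
        \<le> (C + norm H * C) * ((norm a + norm b / norm k) * norm (exp_type T k))"
      by (simp only: distrib_right mult.assoc)
  qed
qed

lemma char_fun_0_asymptotics:
  "(\<lambda>k. char_fun H 0 1 (k\<^sup>2) - cos (k * of_real T)) \<in> O[at_infinity](\<lambda>k. exp_type T k / k)"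
proof -
  obtain C where C: "\<And>a b k. 1 \<le> norm k \<Longrightarrow>
    norm (char_fun H a b (k\<^sup>2) - (b * cos (k * of_real T) - a * (k * sin (k * of_real T))))
      \<le> C * ((norm a + norm b / norm k) * norm (exp_type T k))"
    using char_fun_exp_type_bound by metis
  show ?thesis
    using C[of _ 0 1] by (intro bigoI[of _ C])
      (auto simp: eventually_at_infinity norm_divide intro!: exI[of _ 1])
qed

lemma char_fun_1_asymptotics:
  "(\<lambda>k. char_fun H 1 h (k\<^sup>2) + k * sin (k * of_real T)) \<in> O[at_infinity](exp_type T)"
proof -
  obtain C where C: "\<And>a b k. 1 \<le> norm k \<Longrightarrow>
    norm (char_fun H a b (k\<^sup>2) - (b * cos (k * of_real T) - a * (k * sin (k * of_real T))))
      \<le> C * ((norm a + norm b / norm k) * norm (exp_type T k))"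
    using char_fun_exp_type_bound by metis
  have "norm (char_fun H 1 h (k\<^sup>2) + k * sin (k * of_real T))
      \<le> (norm h + \<bar>C\<bar> * (1 + norm h)) * norm (exp_type T k)" if k: "1 \<le> norm k" for k
  proof -
    let ?free = "h * cos (k * of_real T) - 1 * (k * sin (k * of_real T))"
    have "norm h / norm k \<le> norm h" using k by (simp add: divide_le_eq mult_le_cancel_left1)
    then have "norm (char_fun H 1 h (k\<^sup>2) - ?free) \<le> \<bar>C\<bar> * ((1 + norm h) * norm (exp_type T k))"
      by (intro order_trans[OF C[OF k]] mult_mono mult_right_mono) auto
    moreover have "norm (h * cos (k * of_real T)) \<le> norm h * norm (exp_type T k)"
      using norm_cos_mult_of_real_le[of T k] length_pos
      by (simp add: norm_mult exp_type_def mult_left_mono)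
    ultimately show ?thesis
      using norm_triangle_ineq[of "char_fun H 1 h (k\<^sup>2) - ?free" "h * cos (k * of_real T)"]
      by (simp add: algebra_simps)
  qed
  then show ?thesis by (intro bigoI) (auto simp: eventually_at_infinity)
qed

end

section \<open>Entire functions on expanding squares\<close>

definition csquare :: "real \<Rightarrow> complex set" where
  "csquare r = {z. max \<bar>Re z\<bar> \<bar>Im z\<bar> = r}"

definition along_squares :: "(nat \<Rightarrow> real) \<Rightarrow> complex filter" where
  "along_squares r = inf at_infinity (principal (\<Union>n. csquare (r n)))"

lemma csquare_norm_ge: "z \<in> csquare r \<Longrightarrow> r \<le> norm z"
  using abs_Re_le_cmod[of z] abs_Im_le_cmod[of z] by (auto simp: csquare_def)

lemma along_squares_le_at_infinity: "along_squares r \<le> at_infinity"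
  by (simp add: along_squares_def)

lemma eventually_along_squaresI:
  assumes "\<And>n z. z \<in> csquare (r n) \<Longrightarrow> P z"
  shows "eventually P (along_squares r)"
  unfolding along_squares_def eventually_inf_principal
  by (rule always_eventually) (use assms in blast)

lemma entire_eq_0_if_tendsto_0_along_squares:
  assumes f: "f holomorphic_on UNIV" and r: "filterlim r at_top sequentially"
    and lim: "(f \<longlongrightarrow> 0) (along_squares r)"
  shows "f z = 0"
proof -
  have "norm (f z) \<le> e" if e: "0 < e" for e
  proof -
    have "\<forall>\<^sub>F k in along_squares r. norm (f k) < e"
      using tendstoD[OF lim e] by simp
    then obtain R where R: "\<And>n k. R \<le> norm k \<Longrightarrow> k \<in> csquare (r n) \<Longrightarrow> norm (f k) < e"
      by (auto simp: along_squares_def eventually_inf_principal eventually_at_infinity)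
    obtain n where n: "max R (norm z) \<le> r n"
      using r by (metis eventually_happens filterlim_at_top trivial_limit_sequentially)
    let ?S = "cbox (Complex (- r n) (- r n)) (Complex (r n) (r n))"
    show ?thesis
    proof (rule maximum_modulus_frontier[of f ?S])
      show "f holomorphic_on interior ?S" "continuous_on (closure ?S) f"
        using f by (auto intro: holomorphic_on_subset holomorphic_on_imp_continuous_on)
      show "z \<in> ?S"
        using n abs_Re_le_cmod[of z] abs_Im_le_cmod[of z] by (auto simp: in_cbox_complex_iff)
      fix k assume "k \<in> frontier ?S"
      then have k: "k \<in> csquare (r n)"
        by (auto simp: frontier_cbox in_cbox_complex_iff in_box_complex_iff csquare_def)
      with R[of k n] csquare_norm_ge[OF k] n show "norm (f k) \<le> e" by simp
    qed auto
  qed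
  then have "norm (f z) \<le> 0" by (rule field_le_epsilon[of _ 0, simplified])
  then show ?thesis by simp
qed

lemma entire_eq_0_if_square_tendsto_0_along_squares:
  assumes f: "f holomorphic_on UNIV" and r: "filterlim r at_top sequentially"
    and lim: "((\<lambda>k. f (k\<^sup>2)) \<longlongrightarrow> 0) (along_squares r)"
  shows "f z = 0"
proof -
  have "(\<lambda>k. f (k\<^sup>2)) holomorphic_on UNIV"
    using holomorphic_on_compose_gen[OF _ f, of "\<lambda>k. k\<^sup>2" UNIV]
      holomorphic_on_power[OF holomorphic_on_ident]
    by (simp add: o_def)
  from entire_eq_0_if_tendsto_0_along_squares[OF this r lim, of "csqrt z"] show ?thesis by simp
qed

lemma entire_quotient_simple_zeros:
  assumes f: "f holomorphic_on UNIV" and g: "g holomorphic_on UNIV"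
    and zero: "\<And>z. g z = 0 \<Longrightarrow> f z = 0 \<and> deriv g z \<noteq> 0"
  obtains F where "F holomorphic_on UNIV" "\<And>z. f z = F z * g z"
proof -
  define F where "F z = (if g z = 0 then deriv f z / deriv g z else f z / g z)" for z
  have quotient: "F field_differentiable at z"
    if u: "u holomorphic_on UNIV" and v: "v holomorphic_on UNIV" "v z \<noteq> 0"
      and F: "\<And>w. v w \<noteq> 0 \<Longrightarrow> F w = u w / v w" for u v z
  proof -
    have "isCont v z"
      using holomorphic_on_imp_continuous_on[OF v(1)] by (simp add: continuous_on_eq_continuous_at)
    then have "\<forall>\<^sub>F w in nhds z. v w \<noteq> 0"
      using v(2) by (intro tendsto_imp_eventually_ne[of v "v z"])
        (simp_all add: isCont_def tendsto_at_iff_tendsto_nhds)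
    then have eq: "\<forall>\<^sub>F w in nhds z. F w = u w / v w"
      by eventually_elim (rule F)
    have "(\<lambda>w. u w / v w) field_differentiable at z"
      using u v by (intro field_differentiable_divide) (auto simp: holomorphic_on_def)
    then show ?thesis
      unfolding field_differentiable_def DERIV_cong_ev[OF refl eq refl] .
  qed
  have "F field_differentiable at z" for z
  proof (cases "g z = 0")
    case False
    then show ?thesis by (intro quotient[OF f g]) (auto simp: F_def)
  next
    case True
    let ?slope = "\<lambda>h w. if w = z then deriv h z else (h w - h z) / (w - z)"
    show ?thesis
    proof (rule quotient)
      show "?slope f holomorphic_on UNIV" "?slope g holomorphic_on UNIV"
        using f g by (auto intro: pole_lemma_open)
      show "?slope g z \<noteq> 0" using zero[OF True] by simp
      show "F w = ?slope f w / ?slope g w" if "?slope g w \<noteq> 0" for w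
        using that zero[OF True] True by (auto simp: F_def split: if_splits)
    qed
  qed
  then have "F holomorphic_on UNIV" by (auto simp: holomorphic_on_def)
  moreover have "f z = F z * g z" for z using zero[of z] by (auto simp: F_def)
  ultimately show ?thesis using that by blast
qed

lemma entire_eq_if_asymp_equiv_along_squares:
  assumes f: "f holomorphic_on UNIV" and g: "g holomorphic_on UNIV"
    and zero: "\<And>z. g z = 0 \<Longrightarrow> f z = 0 \<and> deriv g z \<noteq> 0"
    and r: "filterlim r at_top sequentially"
    and equiv: "(\<lambda>k. f (k\<^sup>2)) \<sim>[along_squares r] (\<lambda>k. g (k\<^sup>2))"
    and nonzero: "\<forall>\<^sub>F k in along_squares r. g (k\<^sup>2) \<noteq> 0"
  shows "f z = g z"
proof -
  obtain F where F: "F holomorphic_on UNIV" and eq: "\<And>z. f z = F z * g z"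
    using entire_quotient_simple_zeros[OF f g zero] by blast
  have "F z - 1 = 0"
  proof (rule entire_eq_0_if_square_tendsto_0_along_squares[of "\<lambda>z. F z - 1", OF _ r])
    show "(\<lambda>z. F z - 1) holomorphic_on UNIV" by (intro holomorphic_intros F)
    have "(\<lambda>k. f (k\<^sup>2) - g (k\<^sup>2)) \<in> o[along_squares r](\<lambda>k. g (k\<^sup>2))"
      by (rule asymp_equiv_imp_diff_smallo[OF equiv])
    then have "((\<lambda>k. (f (k\<^sup>2) - g (k\<^sup>2)) / g (k\<^sup>2)) \<longlongrightarrow> 0) (along_squares r)"
      by (rule smalloD_tendsto)
    then show "((\<lambda>k. F (k\<^sup>2) - 1) \<longlongrightarrow> 0) (along_squares r)"
      by (rule Lim_transform_eventually)
        (use nonzero in \<open>eventually_elim; simp add: eq diff_divide_distrib\<close>)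
  qed
  then show ?thesis by (simp add: eq)
qed

section \<open>The characteristic functions along squares\<close>

lemma norm_cos_ge_exp_Im:
  assumes "1 / 2 \<le> (cos (Re z))\<^sup>2 \<or> 1 \<le> \<bar>Im z\<bar>"
  shows "exp \<bar>Im z\<bar> / 4 \<le> norm (cos z)"
proof -
  define e where "e = exp \<bar>Im z\<bar>"
  have e1: "1 \<le> e" by (simp add: e_def)
  have "(exp (Im z) - inverse (exp (Im z)))\<^sup>2 = (e - inverse e)\<^sup>2"
    by (auto simp: e_def abs_if exp_minus power2_commute)
  then have norm: "(norm (cos z))\<^sup>2 = (cos (Re z))\<^sup>2 + (e - inverse e)\<^sup>2 / 4"
    by (simp add: norm_cos_squared)
  have "(e / 4)\<^sup>2 \<le> (norm (cos z))\<^sup>2"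
    using assms
  proof
    assume "1 / 2 \<le> (cos (Re z))\<^sup>2"
    then have "1 / 2 + (e - inverse e)\<^sup>2 / 4 \<le> (norm (cos z))\<^sup>2" using norm by simp
    moreover have "1 / 2 + (e - inverse e)\<^sup>2 / 4 = (e\<^sup>2 + (inverse e)\<^sup>2) / 4"
      using e1 by (simp add: power2_eq_square field_simps)
    moreover have "(e / 4)\<^sup>2 \<le> (e\<^sup>2 + (inverse e)\<^sup>2) / 4" by (simp add: power_divide)
    ultimately show ?thesis by linarith
  next
    assume "1 \<le> \<bar>Im z\<bar>"
    then have "2 \<le> e" unfolding e_def using exp_ge_add_one_self[of "\<bar>Im z\<bar>"] by linarith
    then have "inverse e \<le> e / 2"
      using mult_mono[of 2 e 1 e] by (simp add: field_simps)
    then have "(e / 2)\<^sup>2 \<le> (e - inverse e)\<^sup>2" using e1 by (intro power_mono) auto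
    then have "(e / 2)\<^sup>2 / 4 \<le> (norm (cos z))\<^sup>2" using norm by (simp add: add_increasing)
    then show ?thesis by (simp add: power_divide)
  qed
  then show ?thesis unfolding e_def[symmetric] by (rule power2_le_imp_le) simp
qed

lemma norm_sin_ge_exp_Im:
  assumes "1 / 2 \<le> (sin (Re z))\<^sup>2 \<or> 1 \<le> \<bar>Im z\<bar>"
  shows "exp \<bar>Im z\<bar> / 4 \<le> norm (sin z)"
  using norm_cos_ge_exp_Im[of "of_real pi / 2 - z"] assms by (simp add: sin_cos_eq)

text \<open>By the choice of \<open>5 / 4\<close>, on the vertical sides of these squares \<open>cos\<^sup>2 = sin\<^sup>2 = 1 / 2\<close> at
  \<open>Re (k T)\<close>, and on the horizontal ones \<open>\<bar>Im (k T)\<bar> \<ge> 1\<close>.\<close>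
definition trig_squares :: "real \<Rightarrow> nat \<Rightarrow> real" where
  "trig_squares T n = (real n + 5 / 4) * pi / T"

lemma filterlim_trig_squares: "0 < T \<Longrightarrow> filterlim (trig_squares T) at_top sequentially"
  unfolding trig_squares_def by real_asymp

lemma trig_norm_ge_on_trig_squares:
  assumes T: "0 < T" and k: "k \<in> csquare (trig_squares T n)"
  shows "norm (exp_type T k) \<le> 4 * norm (cos (k * of_real T))"
    and "norm (exp_type T k) \<le> 4 * norm (sin (k * of_real T))"
proof -
  define r where "r = (real n + 5 / 4) * pi"
  have "\<bar>Re k\<bar> = trig_squares T n \<or> \<bar>Im k\<bar> = trig_squares T n"
    using k by (auto simp: csquare_def max_def split: if_splits)
  then consider "\<bar>Re (k * of_real T)\<bar> = r" | "\<bar>Im (k * of_real T)\<bar> = r"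
    using T by (auto simp: trig_squares_def r_def abs_mult)
  then have "((cos (Re (k * of_real T)))\<^sup>2 = 1 / 2 \<and> (sin (Re (k * of_real T)))\<^sup>2 = 1 / 2) \<or>
      1 \<le> \<bar>Im (k * of_real T)\<bar>"
  proof cases
    case 1
    have "cos (2 * \<bar>Re (k * of_real T)\<bar>) = cos (pi / 2 + real (2 * n + 2) * pi)"
      unfolding 1 r_def by (simp add: algebra_simps)
    also have "\<dots> = 0" by (simp only: cos_add sin_npi) simp
    finally have "cos (2 * Re (k * of_real T)) = 0"
      by (simp add: abs_if split: if_splits)
    then show ?thesis
      using cos_double[of "Re (k * of_real T)"] sin_cos_squared_add[of "Re (k * of_real T)"] by simp
  next
    case 2
    have "1 * 1 \<le> r" unfolding r_def using pi_ge_two by (intro mult_mono) auto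
    with 2 show ?thesis by simp
  qed
  then have "exp \<bar>Im (k * of_real T)\<bar> / 4 \<le> norm (cos (k * of_real T))"
    "exp \<bar>Im (k * of_real T)\<bar> / 4 \<le> norm (sin (k * of_real T))"
    by (intro norm_cos_ge_exp_Im norm_sin_ge_exp_Im; auto)+
  then show "norm (exp_type T k) \<le> 4 * norm (cos (k * of_real T))"
    "norm (exp_type T k) \<le> 4 * norm (sin (k * of_real T))"
    using T by (simp_all add: exp_type_def abs_mult)
qed

lemma exp_type_bigo_trig_along_squares:
  assumes "0 < T"
  shows "exp_type T \<in> O[along_squares (trig_squares T)](\<lambda>k. cos (k * of_real T))"
    and "exp_type T \<in> O[along_squares (trig_squares T)](\<lambda>k. sin (k * of_real T))"
  by (rule bigoI[of _ 4], rule eventually_along_squaresI,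
      erule trig_norm_ge_on_trig_squares[OF assms])+

lemma trig_nonzero_along_squares:
  assumes T: "0 < T"
  shows "\<forall>\<^sub>F k in along_squares (trig_squares T). cos (k * of_real T) \<noteq> 0"
    and "\<forall>\<^sub>F k in along_squares (trig_squares T). k \<noteq> 0 \<and> sin (k * of_real T) \<noteq> 0"
proof -
  have "cos (k * of_real T) \<noteq> 0 \<and> k \<noteq> 0 \<and> sin (k * of_real T) \<noteq> 0"
    if "k \<in> csquare (trig_squares T n)" for k n
    using trig_norm_ge_on_trig_squares[OF T that] by (cases "k = 0") auto
  then show "\<forall>\<^sub>F k in along_squares (trig_squares T). cos (k * of_real T) \<noteq> 0"
    "\<forall>\<^sub>F k in along_squares (trig_squares T). k \<noteq> 0 \<and> sin (k * of_real T) \<noteq> 0"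
    by (blast intro: eventually_along_squaresI)+
qed

lemma one_smallo_ident_at_infinity: "(\<lambda>_. 1) \<in> o[at_infinity](\<lambda>k::complex. k)"
  using tendsto_inverse_0
  by (intro smalloI_tendsto) (simp_all add: divide_inverse eventually_not_equal_at_infinity)

lemma exp_type_smallo_mult_sin_along_squares:
  assumes "0 < T"
  shows "exp_type T \<in> o[along_squares (trig_squares T)](\<lambda>k. k * sin (k * of_real T))"
proof -
  have "(\<lambda>k. 1 * sin (k * of_real T))
      \<in> o[along_squares (trig_squares T)](\<lambda>k. k * sin (k * of_real T))"
    by (intro landau_o.small.mult_right landau_o.small.filter_mono[OF along_squares_le_at_infinity]
        one_smallo_ident_at_infinity)
  with exp_type_bigo_trig_along_squares(2)[OF assms] show ?thesis
    by (simp add: landau_o.big_small_trans)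
qed

context sturm_liouville
begin

lemma char_fun_0_asymp_equiv:
  "(\<lambda>k. char_fun H 0 1 (k\<^sup>2)) \<sim>[along_squares (trig_squares T)] (\<lambda>k. cos (k * of_real T))"
proof (rule smallo_imp_asymp_equiv)
  let ?F = "along_squares (trig_squares T)"
  have nonzero: "\<forall>\<^sub>F k::complex in at_infinity. k \<noteq> 0"
    by (rule eventually_not_equal_at_infinity)
  have "(\<lambda>k. exp_type T k * 1) \<in> o[at_infinity](\<lambda>k. exp_type T k * k)"
    by (rule landau_o.small.mult_left[OF one_smallo_ident_at_infinity])
  then have "(\<lambda>k. exp_type T k / k) \<in> o[at_infinity](exp_type T)"
    using landau_o.small.divide_eq2[OF nonzero, of "exp_type T" "exp_type T"] by simp
  then have "(\<lambda>k. char_fun H 0 1 (k\<^sup>2) - cos (k * of_real T)) \<in> o[at_infinity](exp_type T)"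
    by (rule landau_o.big_small_trans[OF char_fun_0_asymptotics])
  then have "(\<lambda>k. char_fun H 0 1 (k\<^sup>2) - cos (k * of_real T)) \<in> o[?F](exp_type T)"
    by (rule landau_o.small.filter_mono[OF along_squares_le_at_infinity])
  then show "(\<lambda>k. char_fun H 0 1 (k\<^sup>2) - cos (k * of_real T)) \<in> o[?F](\<lambda>k. cos (k * of_real T))"
    using exp_type_bigo_trig_along_squares(1)[OF length_pos] by (rule landau_o.small_big_trans)
qed

lemma char_fun_1_asymp_equiv:
  "(\<lambda>k. char_fun H 1 h (k\<^sup>2)) \<sim>[along_squares (trig_squares T)] (\<lambda>k. - (k * sin (k * of_real T)))"
proof (rule smallo_imp_asymp_equiv)
  let ?F = "along_squares (trig_squares T)"
  have "(\<lambda>k. char_fun H 1 h (k\<^sup>2) + k * sin (k * of_real T)) \<in> O[?F](exp_type T)"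
    by (rule landau_o.big.filter_mono[OF along_squares_le_at_infinity char_fun_1_asymptotics])
  then have "(\<lambda>k. char_fun H 1 h (k\<^sup>2) + k * sin (k * of_real T))
      \<in> o[?F](\<lambda>k. k * sin (k * of_real T))"
    using exp_type_smallo_mult_sin_along_squares[OF length_pos] by (rule landau_o.big_small_trans)
  then show "(\<lambda>k. char_fun H 1 h (k\<^sup>2) - - (k * sin (k * of_real T)))
      \<in> o[?F](\<lambda>k. - (k * sin (k * of_real T)))"
    by simp
qed

end

section \<open>Real potentials\<close>

locale real_sturm_liouville = sturm_liouville +
  assumes potential_real: "x \<in> {0..T} \<Longrightarrow> p x \<in> \<real>"
begin

lemma sol_cnj:
  assumes a: "a \<in> \<real>" and b: "b \<in> \<real>" and x: "x \<in> {0..T}"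
  shows "sol a b (cnj l) x = cnj (sol a b l x)" "dsol a b (cnj l) x = cnj (dsol a b l x)"
proof -
  have "sl_solution T (\<lambda>x. p x - cnj l) (\<lambda>x. cnj (sol a b l x)) (\<lambda>x. cnj (dsol a b l x))"
    by (rule sl_solution_cong[OF sl_solution_cnj[OF sl_solution_sol]])
      (use potential_real in \<open>auto simp: Reals_cnj_iff\<close>)
  from sl_solution_eq_sol[OF this x] a b
  show "sol a b (cnj l) x = cnj (sol a b l x)" "dsol a b (cnj l) x = cnj (dsol a b l x)"
    by (simp_all add: Reals_cnj_iff)
qed

lemma integral_sol_cnj_nonzero:
  assumes ab: "a \<in> \<real>" "b \<in> \<real>" "(a, b) \<noteq> (0, 0)" and x: "x \<in> {0<..T}"
  shows "integral {0..x} (\<lambda>t. sol a b l t * sol a b (cnj l) t) \<noteq> 0"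
proof
  have sub: "{0..x} \<subseteq> {0..T}" using x by auto
  have square: "continuous_on {0..x} (\<lambda>t. (norm (sol a b l t))\<^sup>2)"
    by (intro continuous_intros continuous_on_subset[OF continuous_on_sol sub])
  assume "integral {0..x} (\<lambda>t. sol a b l t * sol a b (cnj l) t) = 0"
  also have "integral {0..x} (\<lambda>t. sol a b l t * sol a b (cnj l) t)
      = integral {0..x} (\<lambda>t. complex_of_real ((norm (sol a b l t))\<^sup>2))"
    using sub
    by (intro integral_cong)
      (auto simp: sol_cnj[OF ab(1,2)] complex_norm_square simp del: of_real_power)
  also have "\<dots> = of_real (integral {0..x} (\<lambda>t. (norm (sol a b l t))\<^sup>2))"
    by (intro integral_unique has_integral_of_real integrable_integral
        integrable_continuous_interval square)
  finally have "integral {0..x} (\<lambda>t. (norm (sol a b l t))\<^sup>2) = 0" by (simp only: of_real_eq_0_iff)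
  then have "sol a b l t = 0" if "t \<in> {0..x}" for t
    using that x integral_eq_0_iff[OF square] by auto
  then have "(a, b) = (0, 0)" by (rule sol_eq_0_imp[OF x])
  with ab(3) show False by simp
qed

lemma boundary_zero_imp_real:
  assumes ab: "a \<in> \<real>" "b \<in> \<real>" "(a, b) \<noteq> (0, 0)" and cd: "c \<in> \<real>" "d \<in> \<real>" "(c, d) \<noteq> (0, 0)"
    and x: "x \<in> {0<..T}" and zero: "c * sol a b l x + d * dsol a b l x = 0"
  shows "l \<in> \<real>"
proof -
  have x': "x \<in> {0..T}" using x by auto
  have zero_cnj: "c * sol a b (cnj l) x + d * dsol a b (cnj l) x = 0"
    using arg_cong[OF zero, of cnj] cd by (simp add: sol_cnj[OF ab(1,2) x'] Reals_cnj_iff)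
  have "(l - cnj l) * integral {0..x} (\<lambda>t. sol a b l t * sol a b (cnj l) t)
      = sol a b l x * dsol a b (cnj l) x - dsol a b l x * sol a b (cnj l) x"
    using sol_wronskian[OF x', of a b l a b "cnj l"] by simp
  also have "\<dots> = 0"
  proof -
    have "c * (sol a b l x * dsol a b (cnj l) x - dsol a b l x * sol a b (cnj l) x) = 0"
      "d * (sol a b l x * dsol a b (cnj l) x - dsol a b l x * sol a b (cnj l) x) = 0"
      using zero zero_cnj by algebra+
    then show ?thesis using cd(3) by auto
  qed
  finally have "l = cnj l" using integral_sol_cnj_nonzero[OF ab x] by simp
  then show ?thesis by (simp add: Reals_cnj_iff)
qed

lemma char_fun_deriv_nonzero:
  assumes ab: "a \<in> \<real>" "b \<in> \<real>" "(a, b) \<noteq> (0, 0)" and H: "H \<in> \<real>"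
    and zero: "char_fun H a b m = 0"
  shows "deriv (char_fun H a b) m \<noteq> 0"
proof -
  have T: "T \<in> {0<..T}" using length_pos by simp
  have "cnj m = m"
    using boundary_zero_imp_real[OF ab H _ _ T, of 1] zero
    by (simp add: char_fun_def add.commute Reals_cnj_iff)
  have "((\<lambda>l. - sol a b m T * char_fun H a b l) has_field_derivative
      integral {0..T} (\<lambda>t. sol a b m t * sol a b m t)) (at m)"
    unfolding CARAT_DERIV
  proof (intro exI conjI allI)
    show "- sol a b m T * char_fun H a b l - - sol a b m T * char_fun H a b m
        = integral {0..T} (\<lambda>t. sol a b l t * sol a b m t) * (l - m)" for l
      using sol_wronskian[OF end_mem, of a b l a b m] zero unfolding char_fun_def by algebra
  qed (auto intro: isCont_integral_sol end_mem continuous_on_sol)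
  moreover have "((\<lambda>l. - sol a b m T * char_fun H a b l) has_field_derivative
      - sol a b m T * deriv (char_fun H a b) m) (at m)"
    by (intro DERIV_cmult holomorphic_derivI[OF char_fun_holomorphic_on[of H a b UNIV]]) auto
  ultimately have "- sol a b m T * deriv (char_fun H a b) m
      = integral {0..T} (\<lambda>t. sol a b m t * sol a b (cnj m) t)"
    unfolding \<open>cnj m = m\<close> by (rule DERIV_unique[rotated])
  then show ?thesis using integral_sol_cnj_nonzero[OF ab T, of m] by auto
qed

end

section \<open>Uniqueness from two spectra\<close>

context sturm_liouville
begin

lemma sturm_liouville_reflect: "sturm_liouville T (\<lambda>x. p (T - x))"
proof
  show "continuous_on {0..T} (\<lambda>x. p (T - x))"
    by (intro continuous_on_compose2[OF continuous_potential] continuous_intros) auto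
qed (rule length_pos)

definition end_sol :: "complex \<Rightarrow> complex \<Rightarrow> complex \<Rightarrow> real \<Rightarrow> complex" where
  "end_sol H h l x = char_fun H 0 1 l * sol 1 h l x - char_fun H 1 h l * sol 0 1 l x"

lemma end_sol_eq_sol_reflect:
  assumes x: "x \<in> {0..T}"
  shows "end_sol H h l x = sturm_liouville.sol T (\<lambda>x. p (T - x)) 1 H l (T - x)"
proof -
  interpret R: sturm_liouville T "\<lambda>x. p (T - x)" by (rule sturm_liouville_reflect)
  let ?y = "\<lambda>x. char_fun H 0 1 l * sol 1 h l x + - char_fun H 1 h l * sol 0 1 l x"
  let ?u = "\<lambda>x. char_fun H 0 1 l * dsol 1 h l x + - char_fun H 1 h l * dsol 0 1 l x"
  have "sl_solution T (\<lambda>x. p (T - x) - l) (\<lambda>x. ?y (T - x)) (\<lambda>x. - ?u (T - x))"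
    by (intro sl_solution_reflect[of T "\<lambda>x. p x - l"] sl_solution_lincomb sl_solution_sol)
  moreover have "?y (T - 0) = 1" "- ?u (T - 0) = H"
    using sol_wronskian[OF end_mem, of 1 h l 0 1 l] unfolding char_fun_def by (simp_all, algebra+)
  ultimately have "?y (T - (T - x)) = R.sol 1 H l (T - x)"
    using R.sl_solution_eq_sol(1)[of l "\<lambda>x. ?y (T - x)" "\<lambda>x. - ?u (T - x)" "T - x"] x by simp
  then show ?thesis by (simp add: end_sol_def)
qed

lemma end_sol_bigo_exp_type:
  assumes "x \<in> {0..T}"
  shows "(\<lambda>k. end_sol H h (k\<^sup>2) x) \<in> O[at_infinity](exp_type (T - x))"
  unfolding end_sol_eq_sol_reflect[OF assms]
  by (rule sturm_liouville.sol_bigo_exp_type[OF sturm_liouville_reflect]) (use assms in auto)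

end

lemma sl_solution_cross_product_imp_eq:
  assumes T: "0 < T" and y: "sl_solution T Q y u" and s: "sl_solution T Q s v"
    and y': "sl_solution T Q' y' u'" and s': "sl_solution T Q' s' v'"
    and wronskian: "\<And>x. x \<in> {0..T} \<Longrightarrow> y x * v x - u x * s x = 1"
      "\<And>x. x \<in> {0..T} \<Longrightarrow> y' x * v' x - u' x * s' x = 1"
    and nonzero: "\<And>x. x \<in> {0..T} \<Longrightarrow> y x \<noteq> 0" "\<And>x. x \<in> {0..T} \<Longrightarrow> y' x \<noteq> 0"
    and cross: "\<And>x. x \<in> {0..T} \<Longrightarrow> y x * s' x = s x * y' x" and x: "x \<in> {0..T}"
  shows "Q x = Q' x" "y x * u' x = u x * y' x"
proof -
  note deriv = sl_solutionD[OF y] sl_solutionD[OF s] sl_solutionD[OF y'] sl_solutionD[OF s']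
  have cross_deriv: "y x * v' x + u x * s' x = s x * u' x + v x * y' x" if x: "x \<in> {0..T}" for x
    by (rule has_vector_derivative_Icc_eq[OF has_vector_derivative_mult has_vector_derivative_mult])
      (rule deriv cross x T | assumption)+
  have squares: "y x * y x = y' x * y' x" if x: "x \<in> {0..T}" for x
    using cross[OF x] cross_deriv[OF x] wronskian[OF x] by algebra
  have squares_deriv: "y x * u x + u x * y x = y' x * u' x + u' x * y' x" if x: "x \<in> {0..T}" for x
    by (rule has_vector_derivative_Icc_eq[OF has_vector_derivative_mult has_vector_derivative_mult])
      (rule deriv squares x T | assumption)+
  \<comment> \<open>equality of the logarithmic derivatives \<open>u / y\<close>, whose Riccati equation contains \<open>Q\<close>\<close>
  have log_deriv: "y x * u' x = u x * y' x" if x: "x \<in> {0..T}" for x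
  proof -
    have "y' x * (y x * u' x - u x * y' x) = 0"
      using squares[OF x] squares_deriv[OF x] by algebra
    then show ?thesis using nonzero(2)[OF x] by simp
  qed
  have "y x * (Q' x * y' x) + u x * u' x = u x * u' x + Q x * y x * y' x"
    by (rule has_vector_derivative_Icc_eq[OF has_vector_derivative_mult has_vector_derivative_mult])
      (rule deriv log_deriv x T | assumption)+
  then show "Q x = Q' x" using nonzero[OF x] by simp
  show "y x * u' x = u x * y' x" by (rule log_deriv[OF x])
qed

locale real_sturm_liouville_pair =
  L: real_sturm_liouville T p + L': real_sturm_liouville T p' for T p p'
begin

lemma char_fun_unique:
  assumes real: "a \<in> \<real>" "b \<in> \<real>" "(a, b) \<noteq> (0, 0)" "H \<in> \<real>"
    and zeros: "\<And>l. L.char_fun H a b l = 0 \<longleftrightarrow> L'.char_fun H' a' b' l = 0"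
    and equiv: "(\<lambda>k. L.char_fun H a b (k\<^sup>2)) \<sim>[along_squares (trig_squares T)] m"
      "(\<lambda>k. L'.char_fun H' a' b' (k\<^sup>2)) \<sim>[along_squares (trig_squares T)] m"
    and nonzero: "\<forall>\<^sub>F k in along_squares (trig_squares T). m k \<noteq> 0"
  shows "L'.char_fun H' a' b' l = L.char_fun H a b l"
proof (rule entire_eq_if_asymp_equiv_along_squares[OF L'.char_fun_holomorphic_on
      L.char_fun_holomorphic_on])
  show "filterlim (trig_squares T) at_top sequentially"
    by (rule filterlim_trig_squares[OF L.length_pos])
  show "(\<lambda>k. L'.char_fun H' a' b' (k\<^sup>2)) \<sim>[along_squares (trig_squares T)]
      (\<lambda>k. L.char_fun H a b (k\<^sup>2))"
    using equiv by (metis asymp_equiv_trans asymp_equiv_sym)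
  show "\<forall>\<^sub>F k in along_squares (trig_squares T). L.char_fun H a b (k\<^sup>2) \<noteq> 0"
    using asymp_equiv_eventually_zeros[OF equiv(1)] nonzero by eventually_elim simp
  show "L'.char_fun H' a' b' z = 0 \<and> deriv (L.char_fun H a b) z \<noteq> 0"
    if "L.char_fun H a b z = 0" for z
    using that zeros L.char_fun_deriv_nonzero[OF real that] by simp
qed

lemma sol_cross_product_eq:
  assumes D: "\<And>l. L'.char_fun H' 0 1 l = L.char_fun H 0 1 l"
    and N: "\<And>l. L'.char_fun H' 1 h' l = L.char_fun H 1 h l" and x: "x \<in> {0..T}"
  shows "L.sol 1 h l x * L'.sol 0 1 l x = L.sol 0 1 l x * L'.sol 1 h' l x"
proof -
  let ?F = "along_squares (trig_squares T)"
  define E where "E l = L.sol 1 h l x * L'.sol 0 1 l x - L.sol 0 1 l x * L'.sol 1 h' l x" for l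
  have factor: "L.char_fun H 1 h l * E l
      = L.end_sol H h l x * L'.sol 1 h' l x - L.sol 1 h l x * L'.end_sol H' h' l x" for l
    unfolding E_def L.end_sol_def L'.end_sol_def D N by (simp add: algebra_simps)
  have "(\<lambda>k. L.char_fun H 1 h (k\<^sup>2) * E (k\<^sup>2)) \<in> O[at_infinity](exp_type T)"
    unfolding factor
  proof (rule sum_in_bigo)
    show "(\<lambda>k. L.end_sol H h (k\<^sup>2) x * L'.sol 1 h' (k\<^sup>2) x) \<in> O[at_infinity](exp_type T)"
      using landau_o.big.mult[OF L.end_sol_bigo_exp_type[OF x] L'.sol_bigo_exp_type[OF x]]
      by (simp add: exp_type_mult)
    show "(\<lambda>k. L.sol 1 h (k\<^sup>2) x * L'.end_sol H' h' (k\<^sup>2) x) \<in> O[at_infinity](exp_type T)"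
      using landau_o.big.mult[OF L.sol_bigo_exp_type[OF x] L'.end_sol_bigo_exp_type[OF x]]
      by (simp add: exp_type_mult)
  qed
  then have "(\<lambda>k. L.char_fun H 1 h (k\<^sup>2) * E (k\<^sup>2)) \<in> O[?F](exp_type T)"
    by (rule landau_o.big.filter_mono[OF along_squares_le_at_infinity])
  also have "exp_type T \<in> o[?F](\<lambda>k. k * sin (k * of_real T))"
    by (rule exp_type_smallo_mult_sin_along_squares[OF L.length_pos])
  also have "(\<lambda>k. k * sin (k * of_real T)) \<in> \<Theta>[?F](\<lambda>k. L.char_fun H 1 h (k\<^sup>2))"
    using asymp_equiv_imp_bigtheta[OF L.char_fun_1_asymp_equiv[of H h]] by (simp add: bigtheta_sym)
  finally have "((\<lambda>k. L.char_fun H 1 h (k\<^sup>2) * E (k\<^sup>2) / L.char_fun H 1 h (k\<^sup>2)) \<longlongrightarrow> 0) ?F"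
    by (rule smalloD_tendsto)
  moreover have "\<forall>\<^sub>F k in ?F. L.char_fun H 1 h (k\<^sup>2) * E (k\<^sup>2) / L.char_fun H 1 h (k\<^sup>2) = E (k\<^sup>2)"
    using asymp_equiv_eventually_zeros[OF L.char_fun_1_asymp_equiv[of H h]]
      trig_nonzero_along_squares(2)[OF L.length_pos] by eventually_elim simp
  ultimately have "((\<lambda>k. E (k\<^sup>2)) \<longlongrightarrow> 0) ?F"
    by (rule Lim_transform_eventually)
  moreover have "E holomorphic_on UNIV"
    unfolding E_def by (intro holomorphic_intros L.sol_holomorphic_on L'.sol_holomorphic_on x)
  ultimately have "E l = 0"
    by (rule entire_eq_0_if_square_tendsto_0_along_squares[OF _
          filterlim_trig_squares[OF L.length_pos], rotated])
  then show ?thesis by (simp add: E_def)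
qed

theorem two_spectra_unique:
  assumes real: "h \<in> \<real>" "H \<in> \<real>" "h' \<in> \<real>"
    and robin: "\<And>l. L.char_fun H 1 h l = 0 \<longleftrightarrow> L'.char_fun H' 1 h' l = 0"
    and dirichlet: "\<And>l. L.char_fun H 0 1 l = 0 \<longleftrightarrow> L'.char_fun H' 0 1 l = 0"
  shows "\<And>x. x \<in> {0..T} \<Longrightarrow> p x = p' x" "h = h'" "H = H'"
proof -
  have D: "L'.char_fun H' 0 1 l = L.char_fun H 0 1 l" for l
    by (rule char_fun_unique[OF _ _ _ _ dirichlet
          L.char_fun_0_asymp_equiv L'.char_fun_0_asymp_equiv])
      (use real trig_nonzero_along_squares[OF L.length_pos] in auto)
  have N: "L'.char_fun H' 1 h' l = L.char_fun H 1 h l" for l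
    by (rule char_fun_unique[OF _ _ _ _ robin
          L.char_fun_1_asymp_equiv L'.char_fun_1_asymp_equiv])
      (use real trig_nonzero_along_squares[OF L.length_pos] in auto)
  have nonzero: "L.sol 1 h \<i> x \<noteq> 0" "L'.sol 1 h' \<i> x \<noteq> 0" if "x \<in> {0..T}" for x
    using L.boundary_zero_imp_real[of 1 h 1 0 x \<i>] L'.boundary_zero_imp_real[of 1 h' 1 0 x \<i>]
      real that
    by (cases "x = 0"; force simp: complex_is_Real_iff)+
  have wronskian: "L.sol 1 h \<i> x * L.dsol 0 1 \<i> x - L.dsol 1 h \<i> x * L.sol 0 1 \<i> x = 1"
    "L'.sol 1 h' \<i> x * L'.dsol 0 1 \<i> x - L'.dsol 1 h' \<i> x * L'.sol 0 1 \<i> x = 1"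
    if "x \<in> {0..T}" for x
    using L.sol_wronskian[OF that, of 1 h \<i> 0 1 \<i>] L'.sol_wronskian[OF that, of 1 h' \<i> 0 1 \<i>]
    by simp_all
  have unique: "p x - \<i> = p' x - \<i>"
    "L.sol 1 h \<i> x * L'.dsol 1 h' \<i> x = L.dsol 1 h \<i> x * L'.sol 1 h' \<i> x"
    if "x \<in> {0..T}" for x
    by (rule sl_solution_cross_product_imp_eq[OF L.length_pos L.sl_solution_sol L.sl_solution_sol
          L'.sl_solution_sol L'.sl_solution_sol wronskian nonzero sol_cross_product_eq[OF D N]];
        use that in simp)+
  show potential: "p x = p' x" if "x \<in> {0..T}" for x
    using unique(1)[OF that] by simp
  show "h = h'"
    using unique(2)[of 0] L.length_pos by simp
  have "sl_solution T (\<lambda>x. p' x - \<i>) (L.sol 1 h \<i>) (L.dsol 1 h \<i>)"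
    by (rule sl_solution_cong[OF L.sl_solution_sol]) (simp_all add: potential)
  from L'.sl_solution_eq_sol[OF this L.end_mem]
  have "L.sol 1 h \<i> T = L'.sol 1 h' \<i> T" "L.dsol 1 h \<i> T = L'.dsol 1 h' \<i> T"
    using \<open>h = h'\<close> by simp_all
  then show "H = H'"
    using N[of \<i>] nonzero[OF L.end_mem] by (simp add: L.char_fun_def L'.char_fun_def)
qed

end

section \<open>The conformable problem\<close>

lemma has_vector_derivative_iff_tendsto_slope:
  fixes f :: "real \<Rightarrow> 'a::real_normed_vector"
  shows "(f has_vector_derivative d) (at x within S) \<longleftrightarrow>
    ((\<lambda>y. (f y - f x) /\<^sub>R (y - x)) \<longlongrightarrow> d) (at x within S)"
proof -
  have "(f has_vector_derivative d) (at x within S) \<longleftrightarrow>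
      ((\<lambda>y. (1 / norm (y - x)) *\<^sub>R (f y - (f x + (y - x) *\<^sub>R d))) \<longlongrightarrow> 0) (at x within S)"
    unfolding has_vector_derivative_def has_derivative_within
    by (simp add: bounded_linear_scaleR_left)
  also have "\<dots> \<longleftrightarrow> ((\<lambda>y. norm ((1 / norm (y - x)) *\<^sub>R (f y - (f x + (y - x) *\<^sub>R d)))) \<longlongrightarrow> 0)
      (at x within S)"
    by (rule tendsto_norm_zero_iff[symmetric])
  also have "\<dots> \<longleftrightarrow> ((\<lambda>y. norm ((f y - f x) /\<^sub>R (y - x) - d)) \<longlongrightarrow> 0) (at x within S)"
  proof (rule Lim_cong_within)
    fix y assume "y \<noteq> x"
    then have "(f y - f x) /\<^sub>R (y - x) - d = (f y - (f x + (y - x) *\<^sub>R d)) /\<^sub>R (y - x)"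
      by (simp add: scaleR_diff_right scaleR_add_right)
    then show "norm ((1 / norm (y - x)) *\<^sub>R (f y - (f x + (y - x) *\<^sub>R d)))
        = norm ((f y - f x) /\<^sub>R (y - x) - d)"
      by (simp add: divide_inverse)
  qed auto
  also have "\<dots> \<longleftrightarrow> ((\<lambda>y. (f y - f x) /\<^sub>R (y - x)) \<longlongrightarrow> d) (at x within S)"
    unfolding tendsto_norm_zero_iff by (rule Lim_null[symmetric])
  finally show ?thesis .
qed

lemma conf_deriv_at_iff_has_vector_derivative:
  assumes x: "x \<in> {0<..pi}"
  shows "conf_deriv_at \<alpha> f d x \<longleftrightarrow>
    (f has_vector_derivative x powr (\<alpha> - 1) *\<^sub>R d) (at x within {0..pi})"
proof -
  define c where "c = x powr (1 - \<alpha>)"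
  define s where "s = (\<lambda>e. x + e * c)"
  have c: "0 < c" "x powr (\<alpha> - 1) = inverse c"
    using x by (simp_all add: c_def flip: powr_minus)
  have bij: "bij s"
    by (rule o_bij[of "\<lambda>y. (y - x) / c"]) (use c in \<open>auto simp: s_def fun_eq_iff\<close>)
  have "filtermap s (at 0 within s -` {0..pi}) = at (s 0) within s ` (s -` {0..pi})"
  proof (rule filtermap_linear_at_within[OF bij])
    show "open (s ` S)" if "open S" for S
      using open_affinity[OF that, of c x] c by (simp add: s_def mult.commute)
  qed (auto simp: s_def intro!: continuous_intros)
  then have filter: "filtermap s (at 0 within s -` {0..pi}) = at x within {0..pi}"
    using bij_is_surj[OF bij] by (simp add: s_def surj_image_vimage_eq)
  have slope: "(f (s e) - f x) / of_real e = of_real c * ((f (s e) - f x) /\<^sub>R (s e - x))" for e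
    using c by (simp add: s_def scaleR_conv_of_real divide_inverse)
  have rescale: "of_real c * (d /\<^sub>R c) = d"
    using c by (simp add: scaleR_conv_of_real)
  have "conf_deriv_at \<alpha> f d x \<longleftrightarrow>
      ((\<lambda>e. (f (s e) - f x) / of_real e) \<longlongrightarrow> d) (at 0 within s -` {0..pi})"
    by (simp add: conf_deriv_at_def s_def c_def vimage_def)
  also have "\<dots> \<longleftrightarrow> ((\<lambda>e. of_real c * ((f (s e) - f x) /\<^sub>R (s e - x))) \<longlongrightarrow> of_real c * (d /\<^sub>R c))
      (at 0 within s -` {0..pi})"
    by (simp only: slope rescale)
  also have "\<dots> \<longleftrightarrow> ((\<lambda>e. (f (s e) - f x) /\<^sub>R (s e - x)) \<longlongrightarrow> d /\<^sub>R c) (at 0 within s -` {0..pi})"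
    by (rule tendsto_mult_left_iff) (use c in simp)
  also have "\<dots> \<longleftrightarrow> (f has_vector_derivative d /\<^sub>R c) (at x within {0..pi})"
    unfolding has_vector_derivative_iff_tendsto_slope
    by (simp add: filterlim_filtermap flip: filter)
  finally show ?thesis by (simp add: c)
qed

definition conf_time :: "real \<Rightarrow> real \<Rightarrow> real" where
  "conf_time \<alpha> x = x powr \<alpha> / \<alpha>"

definition conf_time_inv :: "real \<Rightarrow> real \<Rightarrow> real" where
  "conf_time_inv \<alpha> t = (\<alpha> * t) powr (1 / \<alpha>)"

definition conf_potential :: "real \<Rightarrow> (real \<Rightarrow> real) \<Rightarrow> real \<Rightarrow> complex" where
  "conf_potential \<alpha> q t = of_real (q (conf_time_inv \<alpha> t))"

locale conformable =
  fixes \<alpha> :: real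
  assumes order_pos: "0 < \<alpha>"
begin

abbreviation \<tau> :: "real \<Rightarrow> real" where "\<tau> \<equiv> conf_time \<alpha>"
abbreviation \<tau>' :: "real \<Rightarrow> real" where "\<tau>' \<equiv> conf_time_inv \<alpha>"

lemma conf_time_inverse [simp]: "0 \<le> x \<Longrightarrow> \<tau>' (\<tau> x) = x"
  and conf_time_inv_inverse [simp]: "0 \<le> t \<Longrightarrow> \<tau> (\<tau>' t) = t"
  using order_pos by (auto simp: conf_time_def conf_time_inv_def powr_powr)

lemma conf_time_0 [simp]: "\<tau> 0 = 0"
  and conf_time_inv_0 [simp]: "\<tau>' 0 = 0"
  using order_pos by (auto simp: conf_time_def conf_time_inv_def)

lemma conf_time_less_iff:
  assumes "0 \<le> x" "0 \<le> y"
  shows "\<tau> x < \<tau> y \<longleftrightarrow> x < y"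
proof -
  have "\<tau> a < \<tau> b" if "0 \<le> a" "a < b" for a b
    using order_pos that by (simp add: conf_time_def divide_strict_right_mono powr_less_mono2)
  from this[of x y] this[of y x] assms show ?thesis by (cases x y rule: linorder_cases) auto
qed

lemma conf_time_le_iff: "0 \<le> x \<Longrightarrow> 0 \<le> y \<Longrightarrow> \<tau> x \<le> \<tau> y \<longleftrightarrow> x \<le> y"
  by (simp add: conf_time_less_iff flip: linorder_not_less)

lemma conf_time_inv_nonneg: "0 \<le> \<tau>' t"
  by (simp add: conf_time_inv_def)

lemma conf_time_mem: "x \<in> {0..b} \<Longrightarrow> \<tau> x \<in> {0..\<tau> b}"
  using conf_time_le_iff[of 0 x] conf_time_le_iff[of x b] by auto

lemma conf_time_inv_mem: "0 \<le> b \<Longrightarrow> t \<in> {0..\<tau> b} \<Longrightarrow> \<tau>' t \<in> {0..b}"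
  using conf_time_le_iff[of "\<tau>' t" b] conf_time_inv_nonneg[of t] by auto

lemma conf_time_inv_mem_interior: "0 \<le> b \<Longrightarrow> t \<in> {0<..<\<tau> b} \<Longrightarrow> \<tau>' t \<in> {0<..<b}"
  using conf_time_less_iff[of "\<tau>' t" b] conf_time_less_iff[of 0 "\<tau>' t"] conf_time_inv_nonneg[of t]
  by auto

lemma continuous_on_conf_time: "continuous_on {0..b} \<tau>"
  unfolding conf_time_def using order_pos by (intro continuous_intros continuous_on_powr') auto

lemma continuous_on_conf_time_inv: "continuous_on {0..b} \<tau>'"
  unfolding conf_time_inv_def using order_pos by (intro continuous_intros continuous_on_powr') auto

lemma has_vector_derivative_conf_time:
  assumes "0 < x"
  shows "(\<tau> has_vector_derivative x powr (\<alpha> - 1)) (at x within S)"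
  unfolding conf_time_def has_real_derivative_iff_has_vector_derivative[symmetric]
  using DERIV_cdivide[OF has_real_derivative_powr[OF assms, of \<alpha>], of \<alpha>] order_pos
  by (auto intro: has_field_derivative_at_within)

lemma has_vector_derivative_conf_time_inv:
  assumes "0 < t"
  shows "(\<tau>' has_vector_derivative \<tau>' t powr (1 - \<alpha>)) (at t within S)"
proof -
  have "((\<lambda>t. (\<alpha> * t) powr (1 / \<alpha>)) has_real_derivative
      ((1 / \<alpha>) * (\<alpha> * t) powr (1 / \<alpha> - 1)) * (\<alpha> * 1)) (at t)"
    by (rule DERIV_chain'[where f = "\<lambda>t. \<alpha> * t",
          OF DERIV_cmult[OF DERIV_ident] has_real_derivative_powr])
      (use order_pos assms in auto)
  moreover have "(1 / \<alpha>) * (1 - \<alpha>) = 1 / \<alpha> - 1" using order_pos by (simp add: field_simps)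
  ultimately have "(\<tau>' has_vector_derivative \<tau>' t powr (1 - \<alpha>)) (at t)"
    unfolding conf_time_inv_def powr_powr
    using order_pos by (simp add: has_real_derivative_iff_has_vector_derivative)
  then show ?thesis by (rule has_vector_derivative_at_within)
qed

lemma conf_deriv_at_iff_conf_time:
  assumes x: "x \<in> {0<..pi}"
  shows "conf_deriv_at \<alpha> f d x \<longleftrightarrow>
    ((\<lambda>t. f (\<tau>' t)) has_vector_derivative d) (at (\<tau> x) within {0..\<tau> pi})"
  unfolding conf_deriv_at_iff_has_vector_derivative[OF x]
proof
  have \<tau>x: "0 < \<tau> x" "\<tau>' (\<tau> x) = x" using x conf_time_less_iff[of 0 x] by auto
  assume "(f has_vector_derivative x powr (\<alpha> - 1) *\<^sub>R d) (at x within {0..pi})"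
  then have "(f has_vector_derivative x powr (\<alpha> - 1) *\<^sub>R d) (at (\<tau>' (\<tau> x)) within \<tau>' ` {0..\<tau> pi})"
    unfolding \<tau>x(2) by (rule has_vector_derivative_within_subset)
      (use conf_time_inv_mem[of pi] in force)
  from vector_diff_chain_within[OF has_vector_derivative_conf_time_inv[OF \<tau>x(1)] this]
  have "((\<lambda>t. f (\<tau>' t)) has_vector_derivative (x powr (1 - \<alpha>) * x powr (\<alpha> - 1)) *\<^sub>R d)
      (at (\<tau> x) within {0..\<tau> pi})"
    by (simp add: o_def \<tau>x)
  then show "((\<lambda>t. f (\<tau>' t)) has_vector_derivative d) (at (\<tau> x) within {0..\<tau> pi})"
    using x by (simp flip: powr_add)
next
  assume "((\<lambda>t. f (\<tau>' t)) has_vector_derivative d) (at (\<tau> x) within {0..\<tau> pi})"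
  then have "((\<lambda>t. f (\<tau>' t)) has_vector_derivative d) (at (\<tau> x) within \<tau> ` {0..pi})"
    by (rule has_vector_derivative_within_subset) (use conf_time_mem in blast)
  with x have "((\<lambda>t. f (\<tau>' t)) \<circ> \<tau> has_vector_derivative x powr (\<alpha> - 1) *\<^sub>R d)
      (at x within {0..pi})"
    by (intro vector_diff_chain_within has_vector_derivative_conf_time) auto
  then show "(f has_vector_derivative x powr (\<alpha> - 1) *\<^sub>R d) (at x within {0..pi})"
    by (rule has_vector_derivative_transform[rotated 2]) (use x in auto)
qed

lemma conf_sl_solution_imp_sl_solution:
  assumes q: "continuous_on {0..pi} q" and sol: "conf_sl_solution \<alpha> q l y u"
  shows "sl_solution (\<tau> pi) (\<lambda>t. conf_potential \<alpha> q t - l) (\<lambda>t. y (\<tau>' t)) (\<lambda>t. u (\<tau>' t))"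
proof -
  obtain v where cont: "continuous_on {0..pi} y" "continuous_on {0..pi} u"
    and y: "\<And>x. x \<in> {0<..pi} \<Longrightarrow> conf_deriv_at \<alpha> y (u x) x"
    and u: "\<And>x. x \<in> {0<..<pi} \<Longrightarrow> conf_deriv_at \<alpha> u (v x) x"
    and v: "\<And>x. x \<in> {0<..<pi} \<Longrightarrow> - v x + of_real (q x) * y x = l * y x"
    using sol unfolding conf_sl_solution_def by blast
  have compose: "continuous_on {0..\<tau> pi} (\<lambda>t. f (\<tau>' t))" if "continuous_on {0..pi} f"
    for f :: "real \<Rightarrow> 'a::topological_space"
    using conf_time_inv_mem[of pi]
    by (intro continuous_on_compose2[OF that continuous_on_conf_time_inv]) auto
  have interior: "((\<lambda>t. f (\<tau>' t)) has_vector_derivative d (\<tau>' t)) (at t)"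
    if f: "\<And>x. x \<in> {0<..<pi} \<Longrightarrow> conf_deriv_at \<alpha> f (d x) x" and t: "t \<in> {0<..<\<tau> pi}" for f d t
  proof -
    have "\<tau>' t \<in> {0<..<pi}" using t by (rule conf_time_inv_mem_interior[OF pi_ge_zero])
    with f[OF this] show ?thesis
      using conf_deriv_at_iff_conf_time[of "\<tau>' t" f "d (\<tau>' t)"] t by (simp add: at_within_Icc_at)
  qed
  have deriv_u: "conf_deriv_at \<alpha> u ((of_real (q x) - l) * y x) x" if "x \<in> {0<..<pi}" for x
  proof -
    have "v x = (of_real (q x) - l) * y x" using v[OF that] by (simp add: algebra_simps)
    with u[OF that] show ?thesis by simp
  qed
  show ?thesis
    unfolding sl_solution_def conf_potential_def
  proof (intro ballI conjI)
    fix t assume t: "t \<in> {0..\<tau> pi}"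
    show "((\<lambda>t. y (\<tau>' t)) has_vector_derivative u (\<tau>' t)) (at t within {0..\<tau> pi})"
      by (rule has_vector_derivative_Icc_if_interior[OF compose compose interior t])
        (use cont y in auto)
    show "((\<lambda>t. u (\<tau>' t)) has_vector_derivative (of_real (q (\<tau>' t)) - l) * y (\<tau>' t))
        (at t within {0..\<tau> pi})"
      by (rule has_vector_derivative_Icc_if_interior[OF compose compose interior t])
        (use cont q deriv_u in \<open>auto intro!: continuous_intros\<close>)
  qed
qed

lemma sl_solution_imp_conf_sl_solution:
  assumes sol: "sl_solution (\<tau> pi) (\<lambda>t. conf_potential \<alpha> q t - l) z w"
    and nonzero: "\<exists>t\<in>{0..\<tau> pi}. z t \<noteq> 0"
  shows "conf_sl_solution \<alpha> q l (\<lambda>x. z (\<tau> x)) (\<lambda>x. w (\<tau> x))"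
proof -
  have deriv: "conf_deriv_at \<alpha> (\<lambda>x. f (\<tau> x)) d x"
    if x: "x \<in> {0<..pi}" and f: "(f has_vector_derivative d) (at (\<tau> x) within {0..\<tau> pi})" for f d x
    unfolding conf_deriv_at_iff_conf_time[OF x]
    by (rule has_vector_derivative_transform[OF _ _ f]) (use x conf_time_mem in auto)
  have mem: "\<tau> x \<in> {0..\<tau> pi}" if "x \<in> {0<..pi}" for x
    using conf_time_mem[of x pi] that by simp
  show ?thesis
    unfolding conf_sl_solution_def
  proof (intro conjI ballI exI)
    obtain t where t: "t \<in> {0..\<tau> pi}" "z t \<noteq> 0" using nonzero by blast
    then show "\<exists>x\<in>{0..pi}. z (\<tau> x) \<noteq> 0"
      using conf_time_inv_mem[OF pi_ge_zero t(1)] by (intro bexI[of _ "\<tau>' t"]) auto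
    show "continuous_on {0..pi} (\<lambda>x. z (\<tau> x))" "continuous_on {0..pi} (\<lambda>x. w (\<tau> x))"
      using conf_time_mem
      by (auto intro!: continuous_on_conf_time
          continuous_on_compose2[OF sl_solution_continuous_on(1)[OF sol]]
          continuous_on_compose2[OF sl_solution_continuous_on(2)[OF sol]])
    show "conf_deriv_at \<alpha> (\<lambda>x. z (\<tau> x)) (w (\<tau> x)) x" if "x \<in> {0<..pi}" for x
      by (rule deriv[OF that sl_solutionD(1)[OF sol mem[OF that]]])
    fix x assume "x \<in> {0<..<pi}"
    then have x: "x \<in> {0<..pi}" by simp
    show "conf_deriv_at \<alpha> (\<lambda>x. w (\<tau> x)) ((of_real (q x) - l) * z (\<tau> x)) x"
      using deriv[OF x sl_solutionD(2)[OF sol mem[OF x]]] x by (simp add: conf_potential_def)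
    show "- ((of_real (q x) - l) * z (\<tau> x)) + complex_of_real (q x) * z (\<tau> x) = l * z (\<tau> x)"
      by (simp add: algebra_simps)
  qed
qed

end

locale conformable_potential = conformable +
  fixes q :: "real \<Rightarrow> real"
  assumes continuous_q: "continuous_on {0..pi} q"
begin

sublocale real_sturm_liouville "\<tau> pi" "conf_potential \<alpha> q"
proof
  show "0 < \<tau> pi" using conf_time_less_iff[of 0 pi] by simp
  show "continuous_on {0..\<tau> pi} (conf_potential \<alpha> q)"
    unfolding conf_potential_def using conf_time_inv_mem[of pi]
    by (intro continuous_intros
        continuous_on_compose2[OF continuous_q continuous_on_conf_time_inv]) auto
qed (simp add: conf_potential_def)

lemma conf_boundary_iff_char_fun:
  assumes ab: "(a, b) \<noteq> (0, 0)"
  shows "(\<exists>y u. conf_sl_solution \<alpha> q l y u \<and> a * u 0 = b * y 0 \<and> u pi + H * y pi = 0)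
    \<longleftrightarrow> char_fun H a b l = 0"
proof
  assume "\<exists>y u. conf_sl_solution \<alpha> q l y u \<and> a * u 0 = b * y 0 \<and> u pi + H * y pi = 0"
  then obtain y u where conf: "conf_sl_solution \<alpha> q l y u"
    and start: "a * u 0 = b * y 0" and final: "u pi + H * y pi = 0" by blast
  define c where "c = (if a = 0 then u 0 / b else y 0 / a)"
  have c: "y 0 = c * a" "u 0 = c * b"
    using start ab by (auto simp: c_def field_simps)
  have eq: "y (\<tau>' t) = c * sol a b l t" "u (\<tau>' t) = c * dsol a b l t" if "t \<in> {0..\<tau> pi}" for t
    using sl_solution_eq_sol[OF conf_sl_solution_imp_sl_solution[OF continuous_q conf] that]
      sol_scale[OF that]
    by (simp_all add: c)
  obtain x where x: "x \<in> {0..pi}" "y x \<noteq> 0" using conf unfolding conf_sl_solution_def by blast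
  then have "c \<noteq> 0" using eq(1)[OF conf_time_mem[OF x(1)]] by auto
  moreover have "c * char_fun H a b l = 0"
    using final eq[OF end_mem] by (simp add: char_fun_def algebra_simps)
  ultimately show "char_fun H a b l = 0" by simp
next
  assume zero: "char_fun H a b l = 0"
  have "\<exists>t\<in>{0..\<tau> pi}. sol a b l t \<noteq> 0"
  proof (rule ccontr)
    assume "\<not> (\<exists>t\<in>{0..\<tau> pi}. sol a b l t \<noteq> 0)"
    then have "(a, b) = (0, 0)" using length_pos by (intro sol_eq_0_imp[of "\<tau> pi"]) auto
    with ab show False by simp
  qed
  then have "conf_sl_solution \<alpha> q l (\<lambda>x. sol a b l (\<tau> x)) (\<lambda>x. dsol a b l (\<tau> x))"
    by (rule sl_solution_imp_conf_sl_solution[OF sl_solution_sol])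
  moreover have "a * dsol a b l (\<tau> 0) = b * sol a b l (\<tau> 0)" by simp
  moreover have "dsol a b l (\<tau> pi) + H * sol a b l (\<tau> pi) = 0"
    using zero by (simp add: char_fun_def)
  ultimately show "\<exists>y u. conf_sl_solution \<alpha> q l y u \<and> a * u 0 = b * y 0 \<and> u pi + H * y pi = 0"
    by blast
qed

lemma mem_eig_L_iff: "l \<in> eig_L \<alpha> q h H \<longleftrightarrow> char_fun (of_real H) 1 (of_real h) l = 0"
  using conf_boundary_iff_char_fun[of 1 "of_real h" l "of_real H"] by (simp add: eig_L_def)

lemma mem_eig_L1_iff: "l \<in> eig_L1 \<alpha> q H \<longleftrightarrow> char_fun (of_real H) 0 1 l = 0"
  using conf_boundary_iff_char_fun[of 0 1 l "of_real H"] by (simp add: eig_L1_def eq_commute[of 0])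

end

theorem theorem2:
  fixes \<alpha> h H h' H' :: real and q q' :: "real \<Rightarrow> real"
    and lam xi lam' xi' :: "nat \<Rightarrow> real"
  assumes "0 < \<alpha>" "\<alpha> \<le> 1"
    and "continuous_on {0..pi} q" "continuous_on {0..pi} q'"
    and "enumerates_incr lam (eig_L \<alpha> q h H)"
    and "enumerates_incr xi (eig_L1 \<alpha> q H)"
    and "enumerates_incr lam' (eig_L \<alpha> q' h' H')"
    and "enumerates_incr xi' (eig_L1 \<alpha> q' H')"
    and "\<forall>n. lam n = lam' n" and "\<forall>n. xi n = xi' n"
  shows "(AE x in lborel. x \<in> {0..pi} \<longrightarrow> q x = q' x) \<and> h = h' \<and> H = H'"
proof -
  interpret L: conformable_potential \<alpha> q using assms by unfold_locales
  interpret L': conformable_potential \<alpha> q' using assms by unfold_locales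
  interpret real_sturm_liouville_pair "conf_time \<alpha> pi" "conf_potential \<alpha> q" "conf_potential \<alpha> q'" ..
  have "lam = lam'" "xi = xi'" using assms(9,10) by auto
  then have spectra: "eig_L \<alpha> q h H = eig_L \<alpha> q' h' H'" "eig_L1 \<alpha> q H = eig_L1 \<alpha> q' H'"
    using assms(5-8) by (simp_all add: enumerates_incr_def)
  have robin: "L.char_fun H 1 h l = 0 \<longleftrightarrow> L'.char_fun H' 1 h' l = 0" for l
    using spectra(1) L.mem_eig_L_iff L'.mem_eig_L_iff by blast
  have dirichlet: "L.char_fun H 0 1 l = 0 \<longleftrightarrow> L'.char_fun H' 0 1 l = 0" for l
    using spectra(2) L.mem_eig_L1_iff L'.mem_eig_L1_iff by blast
  note unique = two_spectra_unique[OF Reals_of_real Reals_of_real Reals_of_real robin dirichlet]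
  have "q x = q' x" if "x \<in> {0..pi}" for x
    using unique(1)[OF L.conf_time_mem[OF that]] that by (simp add: conf_potential_def)
  then show ?thesis using unique(2,3) by simp
qed

end
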